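(* Let $g_1, g_2$ be independent centred stationary Gaussian processes on $\mathbb{R}$ with covariance kernels $K_i(t) = \mathbb{E}[g_i(0) g_i(t)]$, $i=1,2$. Suppose that for each $i = 1,2$: $g_i$ is not identically zero; $g_i$ is almost surely $C^2$-smooth; and $K_i(t)\log|t| \to 0$ as $|t| \to \infty$. Let $f : \mathbb{R}^2 \to \mathbb{R}$ be the Gaussian field $f(x_1,x_2) = g_1(x_1) + g_2(x_2)$. Suppose $K_1(0) = K_2(0)$ and let $\ell_R \ge 0$ (a deterministic function of $R$). If $\ell_R \sqrt{\log R} \to \infty$ as $R \to \infty$, then $$\mathbb{P}(\mathrm{Cross}_{\ell_R}(R,R)) \to 1 \quad \text{as } R \to \infty,$$ whereas if $\limsup_{R \to \infty} \ell_R \sqrt{\log R} < \infty$, then $$\limsup_{R \to \infty} \mathbb{P}(\mathrm{Cross}_{\ell_R}(R,R)) < 1.$$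
   Context: For $\ell \in \mathbb{R}$ and $a, b > 0$, $\mathrm{Cross}_\ell(a,b)$ denotes the event that there is a left-right path in $\{f \le \ell\} \cap ([0,a] \times [0,b])$, i.e. a (continuous) path contained in this set that intersects both $\{0\} \times [0,b]$ and $\{a\} \times [0,b]$. Here $\{f \le \ell\} = \{x \in \mathbb{R}^2 : f(x) \le \ell\}$. *)

theory Defs
  imports "HOL-Probability.Probability"
begin

text \<open>
  A process on the line is given by its paths, \<^term>\<open>g \<omega> t\<close>. Its law lives on the product
  sigma-algebra of \<^typ>\<open>real \<Rightarrow> real\<close>, i.e. it is the family of finite-dimensional distributions.
\<close>

abbreviation path_space :: "(real \<Rightarrow> real) measure" where
  "path_space \<equiv> PiM UNIV (\<lambda>_. borel)"

text \<open>Point masses count as Gaussian: linear combinations of jointly Gaussian variables may degenerate.\<close>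

definition gaussian_rv :: "'a measure \<Rightarrow> ('a \<Rightarrow> real) \<Rightarrow> bool" where
  "gaussian_rv M X \<longleftrightarrow> X \<in> borel_measurable M \<and>
     ((\<exists>\<mu> \<sigma>. \<sigma> > 0 \<and> distributed M lborel X (normal_density \<mu> \<sigma>)) \<or> (\<exists>\<mu>. AE \<omega> in M. X \<omega> = \<mu>))"

definition gaussian_process :: "'a measure \<Rightarrow> ('a \<Rightarrow> real \<Rightarrow> real) \<Rightarrow> bool" where
  "gaussian_process M g \<longleftrightarrow>
     (\<forall>T c. finite T \<longrightarrow> gaussian_rv M (\<lambda>\<omega>. \<Sum>t\<in>T. c t * g \<omega> t))"

definition centred_process :: "'a measure \<Rightarrow> ('a \<Rightarrow> real \<Rightarrow> real) \<Rightarrow> bool" where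
  "centred_process M g \<longleftrightarrow> (\<forall>t. integrable M (\<lambda>\<omega>. g \<omega> t) \<and> (\<integral>\<omega>. g \<omega> t \<partial>M) = 0)"

definition stationary_process :: "'a measure \<Rightarrow> ('a \<Rightarrow> real \<Rightarrow> real) \<Rightarrow> bool" where
  "stationary_process M g \<longleftrightarrow>
     g \<in> M \<rightarrow>\<^sub>M path_space \<and>
     (\<forall>h. distr M path_space (\<lambda>\<omega> t. g \<omega> (t + h)) = distr M path_space g)"

definition covariance_kernel :: "'a measure \<Rightarrow> ('a \<Rightarrow> real \<Rightarrow> real) \<Rightarrow> real \<Rightarrow> real" where
  "covariance_kernel M g t = (\<integral>\<omega>. g \<omega> 0 * g \<omega> t \<partial>M)"

definition C2_smooth :: "(real \<Rightarrow> real) \<Rightarrow> bool" where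
  "C2_smooth u \<longleftrightarrow> (\<exists>u' u''. (\<forall>t. (u has_real_derivative u' t) (at t)) \<and>
     (\<forall>t. (u' has_real_derivative u'' t) (at t)) \<and> continuous_on UNIV u'')"

definition left_right_crossing :: "(real \<times> real \<Rightarrow> real) \<Rightarrow> real \<Rightarrow> real \<Rightarrow> real \<Rightarrow> bool" where
  "left_right_crossing u l a b \<longleftrightarrow>
     (\<exists>\<gamma>. path \<gamma> \<and> path_image \<gamma> \<subseteq> {x. u x \<le> l} \<inter> ({0..a} \<times> {0..b}) \<and>
          path_image \<gamma> \<inter> ({0} \<times> {0..b}) \<noteq> {} \<and> path_image \<gamma> \<inter> ({a} \<times> {0..b}) \<noteq> {})"

definition Cross :: "'a measure \<Rightarrow> ('a \<Rightarrow> real \<times> real \<Rightarrow> real) \<Rightarrow> real \<Rightarrow> real \<Rightarrow> real \<Rightarrow> 'a set" where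
  "Cross M f l a b = {\<omega> \<in> space M. left_right_crossing (f \<omega>) l a b}"

text \<open>
  Existence of a crossing path is measurable only up to null sets: it agrees with the measurable
  event that a connected subset of the sublevel set joins the two sides once the path of the field
  is smooth and the level is not critical, both of which hold almost surely for the fields
  considered. Hence the probability is taken with respect to the completion.
\<close>

definition cross_prob :: "'a measure \<Rightarrow> ('a \<Rightarrow> real \<times> real \<Rightarrow> real) \<Rightarrow> real \<Rightarrow> real \<Rightarrow> real \<Rightarrow> real" where
  "cross_prob M f l a b = measure (completion M) (Cross M f l a b)"

end

theory Submission
  imports Defs "HOL-Real_Asymp.Real_Asymp"
begin

text \<open>
  A crossing path visits every abscissa, in particular the point where \<open>g1\<close> attains its maximum over
  \<open>[0, R]\<close>; so a crossing exists if and only if \<open>max g1 + min g2 \<le> \<ell>\<close>, in which case a horizontal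
  line through the minimum of \<open>g2\<close> is one (\<open>left_right_crossing_additive_iff\<close>). In terms of the two
  independent processes \<open>g1\<close> and \<open>- g2\<close>, the question is whether the difference of their maxima is at
  most \<open>\<ell>\<close>.

  Write \<open>\<sigma>\<^sup>2\<close> for the common variance and \<open>w = sqrt (2 ln R)\<close>. Under the assumption on the covariances,
  the maximum of either process over \<open>[0, R]\<close> is \<open>\<sigma> (w + Y / w)\<close> with \<open>Y\<close> of Gumbel type. The exact
  limit law is not needed, only two estimates for the probability of exceeding
  \<open>\<sigma> (w + x / w)\<close>: it is at most a multiple of \<open>exp (- x)\<close>
  (\<open>prob_exceeds_extreme_level_le\<close>), and it is bounded below for each \<open>x\<close>, by a bound that can be made
  as close to one as desired by taking \<open>x\<close> negative and large
  (\<open>prob_exceeds_extreme_level_ge\<close>). As the two variances agree, the terms \<open>\<sigma> w\<close> cancel in the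
  difference of the two maxima, which is therefore of order \<open>1 / sqrt (ln R)\<close>. If \<open>\<ell> sqrt (ln R)\<close> tends
  to infinity, then \<open>\<ell>\<close> dominates the difference with probability tending to one. If it stays bounded,
  the event that \<open>g1\<close> exceeds a level above the one which \<open>- g2\<close> does not exceed, by a
  margin larger than \<open>\<ell>\<close>, has probability bounded away from zero by independence.

  The upper estimate counts upcrossings along ever finer dyadic grids. The probability of an upcrossing
  between two neighbours is at most a multiple of the standard deviation of the increment times
  \<open>exp (- u\<^sup>2 / 2)\<close> (\<open>prob_upcrossing_le\<close>), and by the smoothness of the paths that standard deviation is at
  most a multiple of the spacing (\<open>\<rho>_quadratic_bound\<close>).

  The lower estimate is a second moment computation for the number of exceedances on a grid of spacing
  \<open>1 / w\<close>. It involves pairs of points only. Pairs further apart than a small power of \<open>R\<close> are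
  asymptotically independent since their correlation is small compared with \<open>1 / ln R\<close>
  (\<open>weakly_correlated_tail_ratio\<close>). The closer pairs contribute a bounded cluster size because
  \<open>1 - \<rho> t\<close> is at least a multiple of \<open>min (t\<^sup>2) 1\<close>
  (\<open>\<rho>_quadratic_gap\<close>).
\<close>

section \<open>Tails of the normal distribution\<close>

definition normal_tail :: "real \<Rightarrow> real" where
  "normal_tail u = measure std_normal_distribution {u<..}"

lemma emeasure_normal_tail:
  "ennreal (normal_tail u) = (\<integral>\<^sup>+x. ennreal (std_normal_density x) * indicator {u..} x \<partial>lborel)"
proof -
  interpret real_distribution std_normal_distribution by (rule real_dist_normal_dist)
  have "ennreal (normal_tail u) = (\<integral>\<^sup>+x. ennreal (std_normal_density x) * indicator {u<..} x \<partial>lborel)"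
    unfolding normal_tail_def emeasure_eq_measure[symmetric] by (simp add: emeasure_density)
  also have "\<dots> = (\<integral>\<^sup>+x. ennreal (std_normal_density x) * indicator {u..} x \<partial>lborel)"
    using AE_lborel_singleton[of u]
    by (intro nn_integral_cong_AE, eventually_elim) (auto split: split_indicator)
  finally show ?thesis .
qed

lemma DERIV_std_normal_density:
  "(std_normal_density has_real_derivative - x * std_normal_density x) (at x)"
  unfolding std_normal_density_def[abs_def]
  by (rule derivative_eq_intros refl | simp)+

lemma std_normal_density_tendsto_0: "(std_normal_density \<longlongrightarrow> 0) at_top"
  unfolding std_normal_density_def[abs_def] by real_asymp

text \<open>
  The upper half of Mills' ratio: on the half-line above \<open>u\<close> the density is at most \<open>x / u\<close>
  times itself, and \<open>x\<close> times the density is an exact derivative.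
\<close>

lemma normal_tail_le:
  assumes "u > 0" shows "normal_tail u \<le> std_normal_density u / u"
proof -
  have "ennreal (normal_tail u) \<le>
      (\<integral>\<^sup>+x. ennreal (x * std_normal_density x / u) * indicator {u..} x \<partial>lborel)"
    unfolding emeasure_normal_tail
  proof (intro nn_integral_mono)
    fix x show "ennreal (std_normal_density x) * indicator {u..} x
        \<le> ennreal (x * std_normal_density x / u) * indicator {u..} x"
      using assms mult_right_mono[of u x "std_normal_density x"]
      by (auto split: split_indicator intro!: ennreal_leI simp: field_simps)
  qed
  also have "\<dots> = ennreal (0 - (- std_normal_density u / u))"
  proof (rule nn_integral_FTC_atLeast[where F = "\<lambda>x. - std_normal_density x / u"])
    show "((\<lambda>x. - std_normal_density x / u) \<longlongrightarrow> 0) at_top"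
      using tendsto_mult_left[OF std_normal_density_tendsto_0, of "- 1 / u"] by simp
  qed (use assms in \<open>auto intro!: derivative_eq_intros DERIV_std_normal_density\<close>)
  finally show ?thesis using assms by (simp add: ennreal_le_iff)
qed

text \<open>
  The lower half of Mills' ratio: minus the density divided by \<open>x\<close> has derivative
  \<open>(1 + 1 / x\<^sup>2)\<close> times the density, which for \<open>x \<ge> 1\<close> is at most twice the density.
\<close>

lemma normal_tail_ge:
  assumes "u \<ge> 1" shows "std_normal_density u / (2 * u) \<le> normal_tail u"
proof -
  have "ennreal (std_normal_density u / (2 * u)) = ennreal (0 - (- std_normal_density u / (2 * u)))"
    by simp
  also have "\<dots> = (\<integral>\<^sup>+x. ennreal (std_normal_density x * (1 + 1 / x\<^sup>2) / 2) * indicator {u..} x \<partial>lborel)"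
  proof (rule nn_integral_FTC_atLeast[where F = "\<lambda>x. - std_normal_density x / (2 * x)", symmetric])
    show "((\<lambda>x. - std_normal_density x / (2 * x)) \<longlongrightarrow> 0) at_top"
      unfolding std_normal_density_def[abs_def] by real_asymp
  qed (use assms in \<open>auto intro!: derivative_eq_intros DERIV_std_normal_density simp: field_simps power2_eq_square\<close>)
  also have "\<dots> \<le> ennreal (normal_tail u)"
    unfolding emeasure_normal_tail
  proof (intro nn_integral_mono)
    fix x
    have "std_normal_density x * (1 + 1 / x\<^sup>2) / 2 \<le> std_normal_density x" if "u \<le> x"
    proof -
      have "1 / x\<^sup>2 \<le> 1" using that assms by (simp add: field_simps)
      then show ?thesis using mult_left_mono[of "1 + 1 / x\<^sup>2" 2 "std_normal_density x"] by simp
    qed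
    then show "ennreal (std_normal_density x * (1 + 1 / x\<^sup>2) / 2) * indicator {u..} x
        \<le> ennreal (std_normal_density x) * indicator {u..} x"
      by (auto split: split_indicator intro!: ennreal_leI)
  qed
  finally show ?thesis by (simp add: ennreal_le_iff normal_tail_def)
qed

lemma normal_tail_pos:
  assumes "u \<ge> 1" shows "normal_tail u > 0"
proof -
  have "0 < std_normal_density u / (2 * u)" using assms normal_density_pos[of 1 0 u] by simp
  with normal_tail_ge[OF assms] show ?thesis by linarith
qed

lemma normal_tail_mono: "u \<le> v \<Longrightarrow> normal_tail v \<le> normal_tail u"
proof -
  interpret real_distribution std_normal_distribution by (rule real_dist_normal_dist)
  assume "u \<le> v" then show ?thesis unfolding normal_tail_def by (intro finite_measure_mono) auto
qed

lemma std_normal_density_le_exp: "std_normal_density x \<le> exp (- x\<^sup>2 / 2)"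
proof -
  have "1 / sqrt (2 * pi) \<le> 1" using pi_gt3 by simp
  from mult_right_mono[OF this, of "exp (- x\<^sup>2 / 2)"] show ?thesis unfolding std_normal_density_def by simp
qed

lemma normal_tail_le_exp: "u \<ge> 1 \<Longrightarrow> normal_tail u \<le> exp (- u\<^sup>2 / 2)"
proof -
  assume u: "u \<ge> 1"
  have "normal_tail u \<le> std_normal_density u / u" using normal_tail_le u by simp
  also have "\<dots> \<le> std_normal_density u" 
    using u mult_left_mono[of 1 u "std_normal_density u"] by (simp add: divide_le_eq)
  also have "\<dots> \<le> exp (- u\<^sup>2 / 2)" by (rule std_normal_density_le_exp)
  finally show ?thesis .
qed

text \<open>
  Moving the threshold by \<open>a\<close> changes the tail by a relative amount of order \<open>u a\<close>: the density
  on the strip is comparable with the density at \<open>u\<close>, which by Mills' ratio is \<open>u\<close> times the tail.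
\<close>

lemma normal_tail_shift_le:
  assumes "0 \<le> a" "a \<le> u" "1 \<le> u"
  shows "normal_tail (u - a) \<le> normal_tail u * (1 + 2 * u * a * exp (u * a))"
proof -
  interpret real_distribution std_normal_distribution by (rule real_dist_normal_dist)
  have split: "{u - a<..} = {u - a<..u} \<union> {u<..}" using assms by auto
  have "normal_tail (u - a) \<le> measure std_normal_distribution {u - a<..u} + normal_tail u"
    unfolding normal_tail_def split by (rule measure_Un_le) auto
  moreover have "measure std_normal_distribution {u - a<..u} \<le> a * std_normal_density (u - a)"
  proof -
    have "ennreal (measure std_normal_distribution {u - a<..u}) =
       (\<integral>\<^sup>+x. ennreal (std_normal_density x) * indicator {u - a<..u} x \<partial>lborel)"
      unfolding emeasure_eq_measure[symmetric] by (simp add: emeasure_density)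
    also have "\<dots> \<le> (\<integral>\<^sup>+x. ennreal (std_normal_density (u - a)) * indicator {u - a<..u} x \<partial>lborel)"
    proof (intro nn_integral_mono)
      fix x :: real
      have "std_normal_density x \<le> std_normal_density (u - a)" if "u - a < x"
        unfolding std_normal_density_def using that assms
        by (intro mult_left_mono) (auto intro!: power_mono)
      then show "ennreal (std_normal_density x) * indicator {u - a<..u} x
         \<le> ennreal (std_normal_density (u - a)) * indicator {u - a<..u} x"
        by (auto split: split_indicator intro!: ennreal_leI)
    qed
    also have "\<dots> = ennreal (a * std_normal_density (u - a))"
      using assms by (simp add: nn_integral_cmult_indicator ennreal_mult' mult.commute)
    finally show ?thesis using assms by (simp add: ennreal_le_iff)
  qed
  moreover have "std_normal_density (u - a) \<le> std_normal_density u * exp (u * a)"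
  proof -
    have "u * u / 2 - (u - a)\<^sup>2 / 2 = u * a - a * a / 2" by (simp add: power2_eq_square field_simps)
    then have "- (u - a)\<^sup>2 / 2 \<le> - u\<^sup>2 / 2 + u * a"
      using zero_le_square[of a] unfolding power2_eq_square by linarith
    then have "exp (- (u - a)\<^sup>2 / 2) \<le> exp (- u\<^sup>2 / 2) * exp (u * a)"
      by (simp add: exp_add[symmetric])
    then show ?thesis unfolding std_normal_density_def mult.assoc by (intro mult_left_mono) auto
  qed
  moreover have "std_normal_density u \<le> 2 * u * normal_tail u"
    using normal_tail_ge[OF \<open>1 \<le> u\<close>] assms by (simp add: field_simps)
  ultimately have "normal_tail (u - a) \<le> a * (2 * u * normal_tail u * exp (u * a)) + normal_tail u"
    using assms(1) by (meson add_right_mono exp_ge_zero mult_left_mono mult_right_mono order.trans)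
  then show ?thesis by (simp add: algebra_simps)
qed

text \<open>
  The left-hand side is the bound for the probability that two standard normal variables of
  correlation \<open>\<plusminus>r\<close> both exceed \<open>u\<close> that is derived further below. When \<open>r u\<^sup>2\<close> is small it is,
  up to the factor \<open>1 + \<eta>\<close>, what independence would give. This is the point at which the decay of
  the covariance faster than the reciprocal logarithm enters, since there \<open>u\<^sup>2\<close> is about
  \<open>2 ln R\<close>.
\<close>

lemma weakly_correlated_tail_ratio:
  fixes \<eta> :: real assumes "\<eta> > 0"
  obtains \<delta> U where "\<delta> > 0" "U \<ge> 1"
    "\<And>u r. u \<ge> U \<Longrightarrow> 0 \<le> r \<Longrightarrow> r * u\<^sup>2 \<le> \<delta> \<Longrightarrow>
      normal_tail (2 * u) + normal_tail u * normal_tail (u - 2 * r * u) \<le> (1 + \<eta>) * (normal_tail u)\<^sup>2"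
proof -
  \<comment> \<open>The shift to be absorbed is \<open>a = 2 r u\<close>, so \<open>u a\<close> is at most \<open>2 \<delta>\<close>.\<close>
  have "((\<lambda>d::real. 4 * d * exp (2 * d)) \<longlongrightarrow> 0) (at_right 0)" by real_asymp
  then have "eventually (\<lambda>d::real. 4 * d * exp (2 * d) < \<eta> / 2) (at_right 0)"
    using assms by (intro order_tendstoD) auto
  moreover have "eventually (\<lambda>d::real. d < 1/2) (at_right 0)" 
    by (rule eventually_at_right_real[THEN eventually_mono, of 0 "1/2"]) auto
  moreover have "eventually (\<lambda>d::real. d > 0) (at_right 0)" by (rule eventually_at_right_less)
  ultimately have "eventually (\<lambda>d::real. 4 * d * exp (2 * d) < \<eta> / 2 \<and> d < 1/2 \<and> d > 0) (at_right 0)"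
    by eventually_elim auto
  then obtain \<delta> :: real where \<delta>: "4 * \<delta> * exp (2 * \<delta>) < \<eta> / 2" "\<delta> < 1/2" "\<delta> > 0"
    using eventually_happens'[OF trivial_limit_at_right_real] by blast
  have "eventually (\<lambda>u::real. exp (- (2 * u)\<^sup>2 / 2) \<le> \<eta> / 2 * (exp (- u\<^sup>2 / 2) / sqrt (2 * pi) / (2 * u))\<^sup>2) at_top"
    using assms by real_asymp
  then obtain U0 where U0: "\<And>u. u \<ge> U0 \<Longrightarrow>
      exp (- (2 * u)\<^sup>2 / 2) \<le> \<eta> / 2 * (exp (- u\<^sup>2 / 2) / sqrt (2 * pi) / (2 * u))\<^sup>2"
    unfolding eventually_at_top_linorder by blast
  show thesis
  proof (rule that[of \<delta> "max 1 U0"])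
    fix u r :: real assume u: "u \<ge> max 1 U0" and r: "0 \<le> r" "r * u\<^sup>2 \<le> \<delta>"
    have u1: "u \<ge> 1" using u by simp
    have "normal_tail (2 * u) \<le> \<eta> / 2 * (std_normal_density u / (2 * u))\<^sup>2"
      using normal_tail_le_exp[of "2 * u"] U0[of u] u unfolding std_normal_density_def by simp
    also have "\<dots> \<le> \<eta> / 2 * (normal_tail u)\<^sup>2"
      using assms u1 by (intro mult_left_mono power_mono normal_tail_ge) simp_all
    finally have 1: "normal_tail (2 * u) \<le> \<eta> / 2 * (normal_tail u)\<^sup>2" .
    let ?a = "2 * r * u"
    have ua: "u * ?a \<le> 2 * \<delta>" using r by (simp add: power2_eq_square algebra_simps)
    have "r * u \<le> r * u\<^sup>2" using u1 r by (intro mult_left_mono) (auto simp: power2_eq_square)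
    then have "2 * (r * u) \<le> 1" using r \<delta> by linarith
    moreover have "2 * r * u = 2 * (r * u)" by (rule mult.assoc)
    ultimately have "?a \<le> u" using u1 by linarith
    moreover have "0 \<le> ?a" using r u1 by simp
    ultimately have au: "?a \<le> u" "0 \<le> ?a" by blast+
    have x_exp_mono: "2 * x * exp x \<le> 2 * y * exp y" if "0 \<le> x" "x \<le> y" for x y :: real
      using that by (intro mult_mono) auto
    have "2 * u * ?a * exp (u * ?a) = 2 * (u * ?a) * exp (u * ?a)" by simp
    also have "\<dots> \<le> 2 * (2 * \<delta>) * exp (2 * \<delta>)"
      using ua u1 au(2) by (intro x_exp_mono) auto
    also have "\<dots> = 4 * \<delta> * exp (2 * \<delta>)" by simp
    also have "\<dots> \<le> \<eta> / 2" using \<delta> by simp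
    finally have "normal_tail (u - ?a) \<le> normal_tail u * (1 + \<eta> / 2)"
      using normal_tail_shift_le[OF au(2) au(1) u1] mult_left_mono[of "2 * u * ?a * exp (u * ?a)" "\<eta> / 2" "normal_tail u"]
      by (simp add: algebra_simps normal_tail_def)
    then have "normal_tail u * normal_tail (u - ?a) \<le> normal_tail u * (normal_tail u * (1 + \<eta> / 2))"
      by (intro mult_left_mono) (auto simp: normal_tail_def)
    with 1 show "normal_tail (2 * u) + normal_tail u * normal_tail (u - 2 * r * u) \<le> (1 + \<eta>) * (normal_tail u)\<^sup>2"
      by (simp add: algebra_simps power2_eq_square)
  qed (use \<delta> in auto)
qed

section \<open>Jointly normal variables and independence\<close>

text \<open>
  Variance zero is allowed, and then the variable vanishes almost surely: differences such as
  \<open>X s - X t\<close> with \<open>s = t\<close> are covered without a case distinction.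
\<close>

definition centred_normal :: "'a measure \<Rightarrow> ('a \<Rightarrow> real) \<Rightarrow> real \<Rightarrow> bool" where
  "centred_normal M Z v \<longleftrightarrow> Z \<in> borel_measurable M \<and> v \<ge> 0 \<and>
     (if v > 0 then distributed M lborel Z (normal_density 0 (sqrt v)) else AE \<omega> in M. Z \<omega> = 0)"

context prob_space
begin

lemma centred_normal_measurable: "centred_normal M Z v \<Longrightarrow> Z \<in> borel_measurable M"
  by (simp add: centred_normal_def)

lemma centred_normal_variance_nonneg: "centred_normal M Z v \<Longrightarrow> v \<ge> 0"
  by (simp add: centred_normal_def)

lemma centred_normal_second_moment:
  assumes Z: "centred_normal M Z v"
  shows "integrable M (\<lambda>\<omega>. (Z \<omega>)\<^sup>2)" and "expectation (\<lambda>\<omega>. (Z \<omega>)\<^sup>2) = v"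
proof -
  have [measurable]: "Z \<in> borel_measurable M" using Z by (rule centred_normal_measurable)
  have "integrable M (\<lambda>\<omega>. (Z \<omega>)\<^sup>2) \<and> expectation (\<lambda>\<omega>. (Z \<omega>)\<^sup>2) = v"
  proof (cases "v > 0")
    case True
    then have D: "distributed M lborel Z (normal_density 0 (sqrt v))" using Z by (simp add: centred_normal_def)
    have "integrable lborel (\<lambda>x. normal_density 0 (sqrt v) x * x\<^sup>2)"
      using integrable_normal_moment[of "sqrt v" 0 2] True by simp
    then have "integrable M (\<lambda>\<omega>. (Z \<omega>)\<^sup>2)"
      using distributed_integrable[OF D, of "\<lambda>x. x\<^sup>2"] by simp
    moreover have "expectation (\<lambda>\<omega>. (Z \<omega>)\<^sup>2) = v"
      using normal_distributed_variance[OF _ D] normal_distributed_expectation[OF _ D] True by simp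
    ultimately show ?thesis ..
  next
    case False
    then have v: "v = 0" and "AE \<omega> in M. Z \<omega> = 0" using Z by (simp_all add: centred_normal_def)
    then have "AE \<omega> in M. (Z \<omega>)\<^sup>2 = 0" by auto
    then show ?thesis using v integrable_cong_AE[of "\<lambda>\<omega>. (Z \<omega>)\<^sup>2" M "\<lambda>_. 0"]
        integral_cong_AE[of "\<lambda>\<omega>. (Z \<omega>)\<^sup>2" M "\<lambda>_. 0"] by simp
  qed
  then show "integrable M (\<lambda>\<omega>. (Z \<omega>)\<^sup>2)" "expectation (\<lambda>\<omega>. (Z \<omega>)\<^sup>2) = v" by blast+
qed

lemma centred_normal_standardise:
  assumes "centred_normal M Z v" "v > 0"
  shows "distr M borel (\<lambda>\<omega>. Z \<omega> / sqrt v) = std_normal_distribution"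
proof -
  have "distributed M lborel (\<lambda>\<omega>. Z \<omega> / sqrt v) std_normal_density"
    using assms normal_standard_normal_convert[of "sqrt v" Z 0] by (simp add: centred_normal_def)
  from distributed_distr_eq_density[OF this] show ?thesis
    by (metis distr_cong sets_lborel)
qed

lemma prob_centred_normal_greater:
  assumes Z: "centred_normal M Z v" and v: "v > 0"
  shows "prob {\<omega> \<in> space M. Z \<omega> > w} = normal_tail (w / sqrt v)"
proof -
  have [measurable]: "Z \<in> borel_measurable M" using Z by (rule centred_normal_measurable)
  have "normal_tail (w / sqrt v) = measure (distr M borel (\<lambda>\<omega>. Z \<omega> / sqrt v)) {w / sqrt v<..}"
    using centred_normal_standardise[OF assms] by (simp add: normal_tail_def)
  also have "\<dots> = prob ((\<lambda>\<omega>. Z \<omega> / sqrt v) -` {w / sqrt v<..} \<inter> space M)"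
    by (subst measure_distr) auto
  also have "(\<lambda>\<omega>. Z \<omega> / sqrt v) -` {w / sqrt v<..} \<inter> space M = {\<omega> \<in> space M. Z \<omega> > w}"
    using v by (auto simp: divide_less_cancel)
  finally show ?thesis by simp
qed

lemma centred_normal_char:
  assumes Z: "centred_normal M Z v"
  shows "(CLINT \<omega>|M. iexp (a * Z \<omega>)) = exp (- (a\<^sup>2 * v) / 2)"
proof (cases "v = 0")
  case True
  then have "AE \<omega> in M. Z \<omega> = 0" using Z by (simp add: centred_normal_def)
  moreover have [measurable]: "Z \<in> borel_measurable M" using Z by (rule centred_normal_measurable)
  ultimately have "(CLINT \<omega>|M. iexp (a * Z \<omega>)) = (CLINT \<omega>|M. 1)"
    by (intro integral_cong_AE) auto
  then show ?thesis using True by (simp add: prob_space)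
next
  case False
  then have v: "v > 0" using centred_normal_variance_nonneg[OF Z] by simp
  have [measurable]: "Z \<in> borel_measurable M" using Z by (rule centred_normal_measurable)
  have "(CLINT \<omega>|M. iexp (a * Z \<omega>)) = (CLINT \<omega>|M. iexp ((a * sqrt v) * (Z \<omega> / sqrt v)))"
    using v by simp
  also have "\<dots> = char (distr M borel (\<lambda>\<omega>. Z \<omega> / sqrt v)) (a * sqrt v)"
    unfolding char_def by (subst integral_distr) auto
  also have "\<dots> = exp (- ((a * sqrt v)\<^sup>2) / 2)"
    unfolding centred_normal_standardise[OF Z v] char_std_normal_distribution by simp
  also have "\<dots> = exp (- (a\<^sup>2 * v) / 2)" using v by (simp add: power_mult_distrib)
  finally show ?thesis .
qed

text \<open>
  If tilting the measure by a weight \<open>w\<close> does not change the normalised characteristic function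
  of \<open>U\<close>, then by uniqueness on the line it does not change the law of \<open>U\<close>. Applied to suitable
  weights this replaces the uniqueness theorem for characteristic functions in the plane.
\<close>

lemma reweighting_preserves_law:
  fixes w U :: "'a \<Rightarrow> real"
  assumes [measurable]: "w \<in> borel_measurable M" "U \<in> borel_measurable M"
    and w: "\<And>\<omega>. 0 \<le> w \<omega>" "\<And>\<omega>. w \<omega> \<le> C"
    and pos: "expectation w > 0"
    and char: "\<And>a. (CLINT \<omega>|M. w \<omega> *\<^sub>R iexp (a * U \<omega>)) = expectation w *\<^sub>R (CLINT \<omega>|M. iexp (a * U \<omega>))"
    and [measurable]: "B \<in> sets borel"
  shows "(\<integral>\<omega>. w \<omega> * indicator B (U \<omega>) \<partial>M) = expectation w * prob (U -` B \<inter> space M)"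
proof -
  define c where "c = expectation w"
  have c: "c > 0" using pos by (simp add: c_def)
  have int_w: "integrable M w"
    using w by (intro integrable_const_bound[of _ C]) (auto simp: abs_of_nonneg)
  define N where "N = density M (\<lambda>\<omega>. ennreal (w \<omega> / c))"
  have w': "AE \<omega> in M. 0 \<le> w \<omega> / c" using w c by simp
  interpret N: prob_space N
  proof
    have "emeasure N (space N) = (\<integral>\<^sup>+\<omega>. ennreal (w \<omega> / c) \<partial>M)"
      unfolding N_def by (simp add: emeasure_density cong: nn_integral_cong)
    also have "\<dots> = ennreal (\<integral>\<omega>. w \<omega> / c \<partial>M)"
      using int_w w c by (intro nn_integral_eq_integral) auto
    also have "\<dots> = 1" using c by (simp add: c_def)
    finally show "emeasure N (space N) = 1" .
  qed
  have [measurable]: "U \<in> borel_measurable N" "random_variable borel U" unfolding N_def by simp_all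
  have "distr N borel U = distr M borel U"
  proof (rule Levy_uniqueness)
    show "real_distribution (distr N borel U)" by (rule N.real_distribution_distr) simp
    show "real_distribution (distr M borel U)" by (rule real_distribution_distr) simp
    show "char (distr N borel U) = char (distr M borel U)"
    proof
      fix a
      have "char (distr N borel U) a = (CLINT \<omega>|N. iexp (a * U \<omega>))"
        unfolding char_def by (subst integral_distr) auto
      also have "\<dots> = (CLINT \<omega>|M. (w \<omega> / c) *\<^sub>R iexp (a * U \<omega>))"
        unfolding N_def using w' by (subst integral_density) auto
      also have "\<dots> = (CLINT \<omega>|M. (1 / c) *\<^sub>R (w \<omega> *\<^sub>R iexp (a * U \<omega>)))"
        by (intro Bochner_Integration.integral_cong) auto
      also have "\<dots> = (1 / c) *\<^sub>R (CLINT \<omega>|M. w \<omega> *\<^sub>R iexp (a * U \<omega>))"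
        by (rule integral_scaleR_right)
      also have "\<dots> = (CLINT \<omega>|M. iexp (a * U \<omega>))"
        unfolding char c_def[symmetric] using c by simp
      also have "\<dots> = char (distr M borel U) a"
        unfolding char_def by (subst integral_distr) auto
      finally show "char (distr N borel U) a = char (distr M borel U) a" .
    qed
  qed
  then have "prob (U -` B \<inter> space M) = measure N (U -` B \<inter> space N)"
    by (metis \<open>U \<in> borel_measurable N\<close> \<open>random_variable borel U\<close> \<open>B \<in> sets borel\<close> measure_distr)
  also have "\<dots> = (\<integral>\<omega>. indicator (U -` B \<inter> space N) \<omega> \<partial>N)"
    by simp
  also have "\<dots> = (\<integral>\<omega>. indicator B (U \<omega>) \<partial>N)"
    by (intro Bochner_Integration.integral_cong) (auto split: split_indicator)
  also have "\<dots> = (\<integral>\<omega>. (w \<omega> / c) *\<^sub>R indicator B (U \<omega>) \<partial>M)"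
    unfolding N_def using w' by (subst integral_density) auto
  also have "\<dots> = (\<integral>\<omega>. w \<omega> * indicator B (U \<omega>) \<partial>M) / c"
    by simp
  finally show ?thesis using c by (simp add: c_def field_simps)
qed

text \<open>
  First, the weights \<open>2 + cos (b V + \<theta>)\<close>, whose tilted characteristic functions are combinations
  of the joint one, leave the law of \<open>U\<close> unchanged; hence so does the complex weight
  \<open>exp (i b V)\<close>. This says that the weight \<open>1 + indicator A U\<close> leaves the characteristic function
  of \<open>V\<close> unchanged, and so its law, which is the product formula. The constants \<open>2\<close> and \<open>1\<close> keep
  the weights nonnegative and their total mass positive.
\<close>

lemma indep_var_if_joint_char_factors:
  fixes U V :: "'a \<Rightarrow> real"
  assumes U[measurable]: "U \<in> borel_measurable M" and V[measurable]: "V \<in> borel_measurable M"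
    and factor: "\<And>a b. (CLINT \<omega>|M. iexp (a * U \<omega> + b * V \<omega>)) =
       (CLINT \<omega>|M. iexp (a * U \<omega>)) * (CLINT \<omega>|M. iexp (b * V \<omega>))"
  shows "indep_var borel U borel V"
proof -
  have int_b: "integrable M f" if "f \<in> borel_measurable M" "\<And>\<omega>. norm (f \<omega>) \<le> 3" for f :: "'a \<Rightarrow> complex"
    using that by (intro integrable_const_bound[of _ 3]) auto
  have int_r: "integrable M f" if "f \<in> borel_measurable M" "\<And>\<omega>. norm (f \<omega>) \<le> 3" for f :: "'a \<Rightarrow> real"
    using that by (intro integrable_const_bound[of _ 3]) auto
  have cos_eq: "complex_of_real (cos (b * V \<omega> + \<theta>)) =
     (iexp \<theta> * iexp (b * V \<omega>) + iexp (- \<theta>) * iexp (- b * V \<omega>)) / 2" for b \<theta> \<omega>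
    by (simp add: cos_exp_eq exp_add[symmetric] cos_of_real[symmetric] algebra_simps)
  have cosU: "(CLINT \<omega>|M. cos (b * V \<omega> + \<theta>) *\<^sub>R iexp (a * U \<omega>)) =
      expectation (\<lambda>\<omega>. cos (b * V \<omega> + \<theta>)) *\<^sub>R (CLINT \<omega>|M. iexp (a * U \<omega>))" for a b \<theta>
  proof -
    have "(CLINT \<omega>|M. cos (b * V \<omega> + \<theta>) *\<^sub>R iexp (a' * U \<omega>)) =
      (CLINT \<omega>|M. (iexp \<theta> / 2) * iexp (a' * U \<omega> + b * V \<omega>) + (iexp (- \<theta>) / 2) * iexp (a' * U \<omega> + (- b) * V \<omega>))" for a'
      unfolding scaleR_conv_of_real cos_eq
      by (intro Bochner_Integration.integral_cong) (auto simp: exp_add exp_diff exp_minus field_simps)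
    also have "\<dots> a' = (iexp \<theta> / 2) * (CLINT \<omega>|M. iexp (a' * U \<omega> + b * V \<omega>)) +
        (iexp (- \<theta>) / 2) * (CLINT \<omega>|M. iexp (a' * U \<omega> + (- b) * V \<omega>))" for a'
      by (subst Bochner_Integration.integral_add)
         (auto intro!: int_b simp: norm_mult simp del: of_real_add of_real_mult of_real_minus of_real_diff)
    finally have *: "(CLINT \<omega>|M. cos (b * V \<omega> + \<theta>) *\<^sub>R iexp (a' * U \<omega>)) =
      (CLINT \<omega>|M. iexp (a' * U \<omega>)) * ((iexp \<theta> / 2) * (CLINT \<omega>|M. iexp (b * V \<omega>)) +
        (iexp (- \<theta>) / 2) * (CLINT \<omega>|M. iexp ((- b) * V \<omega>)))" for a'
      unfolding factor by (simp add: algebra_simps)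
    then obtain K where K: "(CLINT \<omega>|M. cos (b * V \<omega> + \<theta>) *\<^sub>R iexp (a' * U \<omega>)) =
      (CLINT \<omega>|M. iexp (a' * U \<omega>)) * K" for a' by blast
    have "complex_of_real (expectation (\<lambda>\<omega>. cos (b * V \<omega> + \<theta>))) = K"
      using K[of 0] by (simp add: scaleR_conv_of_real prob_space)
    then show ?thesis unfolding scaleR_conv_of_real[of "expectation _"] K by simp
  qed
  have cosB: "(\<integral>\<omega>. cos (b * V \<omega> + \<theta>) * indicator A (U \<omega>) \<partial>M) =
      expectation (\<lambda>\<omega>. cos (b * V \<omega> + \<theta>)) * prob (U -` A \<inter> space M)" if [measurable]: "A \<in> sets borel" for A b \<theta>
  proof -
    let ?w = "\<lambda>\<omega>. 2 + cos (b * V \<omega> + \<theta>)"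
    have 1: "expectation ?w = 2 + expectation (\<lambda>\<omega>. cos (b * V \<omega> + \<theta>))"
      by (subst Bochner_Integration.integral_add) (auto intro!: int_r abs_cos_le_one[THEN order.trans] simp: prob_space)
    have "(- 1 :: real) = expectation (\<lambda>_. - 1)" by (simp add: prob_space)
    also have "\<dots> \<le> expectation (\<lambda>\<omega>. cos (b * V \<omega> + \<theta>))"
      by (intro integral_mono int_r) (auto intro!: abs_cos_le_one[THEN order.trans])
    finally have 2: "expectation ?w > 0" unfolding 1 by simp
    have "(\<integral>\<omega>. ?w \<omega> * indicator A (U \<omega>) \<partial>M) = expectation ?w * prob (U -` A \<inter> space M)"
    proof (rule reweighting_preserves_law[where C = 3])
      fix a
      have "(CLINT \<omega>|M. ?w \<omega> *\<^sub>R iexp (a * U \<omega>)) =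
          (CLINT \<omega>|M. 2 *\<^sub>R iexp (a * U \<omega>) + cos (b * V \<omega> + \<theta>) *\<^sub>R iexp (a * U \<omega>))"
        by (simp add: scaleR_add_left)
      also have "\<dots> = 2 *\<^sub>R (CLINT \<omega>|M. iexp (a * U \<omega>)) + (CLINT \<omega>|M. cos (b * V \<omega> + \<theta>) *\<^sub>R iexp (a * U \<omega>))"
        by (subst Bochner_Integration.integral_add)
           (auto intro!: int_b abs_cos_le_one[THEN order.trans])
      finally show "(CLINT \<omega>|M. ?w \<omega> *\<^sub>R iexp (a * U \<omega>)) = expectation ?w *\<^sub>R (CLINT \<omega>|M. iexp (a * U \<omega>))"
        unfolding cosU 1 by (simp add: scaleR_add_left)
    next
      show "0 \<le> ?w \<omega>" for \<omega> using cos_ge_minus_one[of "b * V \<omega> + \<theta>"] by linarith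
      show "?w \<omega> \<le> 3" for \<omega> using cos_le_one[of "b * V \<omega> + \<theta>"] by linarith
    qed (use 2 in auto)
    moreover have "(\<integral>\<omega>. ?w \<omega> * indicator A (U \<omega>) \<partial>M) =
       2 * prob (U -` A \<inter> space M) + (\<integral>\<omega>. cos (b * V \<omega> + \<theta>) * indicator A (U \<omega>) \<partial>M)"
    proof -
      have "(\<integral>\<omega>. indicator A (U \<omega>) \<partial>M) = (\<integral>\<omega>. indicator (U -` A \<inter> space M) \<omega> \<partial>M :: real)"
        by (intro Bochner_Integration.integral_cong) (auto split: split_indicator)
      also have "\<dots> = prob (U -` A \<inter> space M)" by simp
      finally have "(\<integral>\<omega>. indicator A (U \<omega>) \<partial>M) = prob (U -` A \<inter> space M)" .
      then show ?thesis unfolding ring_distribs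
        by (subst Bochner_Integration.integral_add)
          (auto intro!: int_r abs_cos_le_one[THEN order.trans] split: split_indicator)
    qed
    ultimately show ?thesis unfolding 1 by (simp add: algebra_simps)
  qed
  have "prob (U -` A \<inter> V -` B \<inter> space M) = prob (U -` A \<inter> space M) * prob (V -` B \<inter> space M)"
    if [measurable]: "A \<in> sets borel" "B \<in> sets borel" for A B
  proof -
    let ?w = "\<lambda>\<omega>. 1 + indicator A (U \<omega>) :: real"
    have ind: "(\<integral>\<omega>. indicator C (W \<omega>) \<partial>M) = prob (W -` C \<inter> space M)" if [measurable]: "C \<in> sets borel" "W \<in> borel_measurable M"
      for C and W :: "'a \<Rightarrow> real"
    proof -
      have "(\<integral>\<omega>. indicator C (W \<omega>) \<partial>M) = (\<integral>\<omega>. indicator (W -` C \<inter> space M) \<omega> \<partial>M :: real)"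
        by (intro Bochner_Integration.integral_cong) (auto split: split_indicator)
      then show ?thesis by simp
    qed
    have 1: "expectation ?w = 1 + prob (U -` A \<inter> space M)"
      by (subst Bochner_Integration.integral_add) (auto intro!: int_r simp: ind prob_space split: split_indicator)
    have "(\<integral>\<omega>. ?w \<omega> * indicator B (V \<omega>) \<partial>M) = expectation ?w * prob (V -` B \<inter> space M)"
    proof (rule reweighting_preserves_law[where C = 2])
      fix b
      have euler: "iexp x = complex_of_real (cos (x + 0)) + \<i> * complex_of_real (cos (x + (- pi / 2)))" for x :: real
        by (simp add: exp_Euler cos_of_real sin_of_real cos_add cos_diff)
      have weighted: "(CLINT \<omega>|M. complex_of_real (h \<omega>) * iexp (b * V \<omega>)) =
           complex_of_real (\<integral>\<omega>. cos (b * V \<omega> + 0) * h \<omega> \<partial>M) + \<i> * complex_of_real (\<integral>\<omega>. cos (b * V \<omega> + (- pi / 2)) * h \<omega> \<partial>M)"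
        if [measurable]: "h \<in> borel_measurable M" and h: "\<And>\<omega>. \<bar>h \<omega>\<bar> \<le> 1" for h
      proof -
        have bd: "\<bar>cos y * h \<omega>\<bar> \<le> 3" for y \<omega>
          using mult_mono[OF abs_cos_le_one[of y] h[of \<omega>]] by (simp add: abs_mult)
        have "(CLINT \<omega>|M. complex_of_real (h \<omega>) * iexp (b * V \<omega>)) =
          (CLINT \<omega>|M. complex_of_real (cos (b * V \<omega> + 0) * h \<omega>) + \<i> * complex_of_real (cos (b * V \<omega> + (- pi / 2)) * h \<omega>))"
          unfolding euler by (intro Bochner_Integration.integral_cong) (auto simp: algebra_simps)
        also have "\<dots> = (CLINT \<omega>|M. complex_of_real (cos (b * V \<omega> + 0) * h \<omega>)) +
            (CLINT \<omega>|M. \<i> * complex_of_real (cos (b * V \<omega> + (- pi / 2)) * h \<omega>))"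
          by (intro Bochner_Integration.integral_add int_b)
             (auto simp: norm_mult bd simp del: of_real_mult of_real_add)
        finally show ?thesis by (simp del: of_real_mult of_real_add)
      qed
      have "(CLINT \<omega>|M. indicator A (U \<omega>) * iexp (b * V \<omega>)) =
          (CLINT \<omega>|M. complex_of_real (indicator A (U \<omega>)) * iexp (b * V \<omega>))"
        by (intro Bochner_Integration.integral_cong) (auto split: split_indicator)
      also have "\<dots> = prob (U -` A \<inter> space M) * (CLINT \<omega>|M. complex_of_real 1 * iexp (b * V \<omega>))"
      proof -
        have "(CLINT \<omega>|M. complex_of_real (indicator A (U \<omega>)) * iexp (b * V \<omega>)) =
          complex_of_real (\<integral>\<omega>. cos (b * V \<omega> + 0) * indicator A (U \<omega>) \<partial>M) +
          \<i> * complex_of_real (\<integral>\<omega>. cos (b * V \<omega> + (- pi / 2)) * indicator A (U \<omega>) \<partial>M)"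
          by (rule weighted) (auto split: split_indicator)
        moreover have "(CLINT \<omega>|M. complex_of_real 1 * iexp (b * V \<omega>)) =
          complex_of_real (\<integral>\<omega>. cos (b * V \<omega> + 0) * 1 \<partial>M) +
          \<i> * complex_of_real (\<integral>\<omega>. cos (b * V \<omega> + (- pi / 2)) * 1 \<partial>M)"
          by (rule weighted) auto
        ultimately show ?thesis
          unfolding cosB[OF \<open>A \<in> sets borel\<close>] by (simp only: of_real_mult mult_1_left mult_1_right ring_distribs mult_ac)
      qed
      finally have *: "(CLINT \<omega>|M. indicator A (U \<omega>) * iexp (b * V \<omega>)) =
          prob (U -` A \<inter> space M) * (CLINT \<omega>|M. iexp (b * V \<omega>))" by simp
      have "(CLINT \<omega>|M. ?w \<omega> *\<^sub>R iexp (b * V \<omega>)) =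
          (CLINT \<omega>|M. iexp (b * V \<omega>) + indicator A (U \<omega>) * iexp (b * V \<omega>))"
        by (intro Bochner_Integration.integral_cong) (auto split: split_indicator simp: scaleR_conv_of_real)
      also have "\<dots> = (CLINT \<omega>|M. iexp (b * V \<omega>)) + (CLINT \<omega>|M. indicator A (U \<omega>) * iexp (b * V \<omega>))"
        by (intro Bochner_Integration.integral_add int_b) (auto split: split_indicator)
      finally show "(CLINT \<omega>|M. ?w \<omega> *\<^sub>R iexp (b * V \<omega>)) = expectation ?w *\<^sub>R (CLINT \<omega>|M. iexp (b * V \<omega>))"
        unfolding * 1 by (simp add: scaleR_conv_of_real algebra_simps)
    next
      show "expectation ?w > 0" unfolding 1 by (simp add: add_pos_nonneg)
    qed (auto split: split_indicator)
    moreover have "(\<integral>\<omega>. ?w \<omega> * indicator B (V \<omega>) \<partial>M) =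
        (\<integral>\<omega>. indicator B (V \<omega>) \<partial>M) + (\<integral>\<omega>. indicator (U -` A \<inter> V -` B \<inter> space M) \<omega> \<partial>M)"
    proof -
      have "(\<integral>\<omega>. ?w \<omega> * indicator B (V \<omega>) \<partial>M) =
        (\<integral>\<omega>. indicator B (V \<omega>) + indicator (U -` A \<inter> V -` B \<inter> space M) \<omega> \<partial>M)"
        by (intro Bochner_Integration.integral_cong) (auto split: split_indicator)
      also have "\<dots> = (\<integral>\<omega>. indicator B (V \<omega>) \<partial>M) + (\<integral>\<omega>. indicator (U -` A \<inter> V -` B \<inter> space M) \<omega> \<partial>M)"
        by (intro Bochner_Integration.integral_add int_r) (auto split: split_indicator)
      finally show ?thesis .
    qed
    ultimately show ?thesis unfolding 1 by (simp add: ind algebra_simps)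
  qed
  then show ?thesis
    unfolding indep_var_eq
  proof (intro conjI U V indep_set_sigma_sets)
    have stable: "Int_stable {X -` A \<inter> space M |A. A \<in> sets borel}" for X :: "'a \<Rightarrow> real"
    proof (safe intro!: Int_stableI)
      fix A B :: "real set" assume "A \<in> sets borel" "B \<in> sets borel"
      then show "\<exists>C. (X -` A \<inter> space M) \<inter> (X -` B \<inter> space M) = X -` C \<inter> space M \<and> C \<in> sets borel"
        by (intro exI[of _ "A \<inter> B"]) auto
    qed
    then show "Int_stable {U -` A \<inter> space M |A. A \<in> sets borel}"
      and "Int_stable {V -` A \<inter> space M |A. A \<in> sets borel}" by blast+
    assume product: "\<And>A B. A \<in> sets borel \<Longrightarrow> B \<in> sets borel \<Longrightarrow>
        prob (U -` A \<inter> V -` B \<inter> space M) = prob (U -` A \<inter> space M) * prob (V -` B \<inter> space M)"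
    have "(U -` A \<inter> space M) \<inter> (V -` B \<inter> space M) = U -` A \<inter> V -` B \<inter> space M" for A B by auto
    with product show "indep_set {U -` A \<inter> space M |A. A \<in> sets borel} {V -` A \<inter> space M |A. A \<in> sets borel}"
      by (intro indep_setI) auto
  qed
qed

text \<open>
  The absence of a mixed term in the variance says that \<open>U\<close> and \<open>V\<close> are uncorrelated.
\<close>

lemma indep_var_centred_normal:
  assumes "\<And>a b. centred_normal M (\<lambda>\<omega>. a * U \<omega> + b * V \<omega>) (a\<^sup>2 * p + b\<^sup>2 * q)"
  shows "indep_var borel U borel V"
proof (rule indep_var_if_joint_char_factors)
  have U: "centred_normal M (\<lambda>\<omega>. a * U \<omega>) (a\<^sup>2 * p)" for a using assms[of a 0] by simp
  have V: "centred_normal M (\<lambda>\<omega>. b * V \<omega>) (b\<^sup>2 * q)" for b using assms[of 0 b] by simp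
  show "U \<in> borel_measurable M" using centred_normal_measurable[OF U[of 1]] by simp
  show "V \<in> borel_measurable M" using centred_normal_measurable[OF V[of 1]] by simp
  fix a b
  show "(CLINT \<omega>|M. iexp (a * U \<omega> + b * V \<omega>)) = (CLINT \<omega>|M. iexp (a * U \<omega>)) * (CLINT \<omega>|M. iexp (b * V \<omega>))"
    using centred_normal_char[OF assms[of a b], of 1] centred_normal_char[OF U[of a], of 1]
      centred_normal_char[OF V[of b], of 1]
    by (simp add: exp_add[symmetric] exp_of_real[symmetric] algebra_simps diff_divide_distrib del: of_real_mult)
qed

end

section \<open>Pairs of correlated normal variables\<close>

context prob_space
begin

text \<open>
  The moment generating function, by completing the square.
\<close>

lemma nn_integral_normal_exp:
  assumes d: "d > 0"
  shows "(\<integral>\<^sup>+y. ennreal (normal_density 0 d y) * ennreal (exp (a * y)) \<partial>lborel) = ennreal (exp (a\<^sup>2 * d\<^sup>2 / 2))"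
proof -
  have sq: "normal_density 0 d y * exp (a * y) = exp (a\<^sup>2 * d\<^sup>2 / 2) * normal_density (a * d\<^sup>2) d y" for y
  proof -
    have "- (y\<^sup>2) / (2 * d\<^sup>2) + a * y = a\<^sup>2 * d\<^sup>2 / 2 + - (y - a * d\<^sup>2)\<^sup>2 / (2 * d\<^sup>2)"
      using d by (simp add: field_simps power2_eq_square)
    then have "exp (- (y\<^sup>2) / (2 * d\<^sup>2)) * exp (a * y) = exp (a\<^sup>2 * d\<^sup>2 / 2) * exp (- (y - a * d\<^sup>2)\<^sup>2 / (2 * d\<^sup>2))"
      unfolding exp_add[symmetric] by (rule arg_cong)
    then show ?thesis by (simp add: normal_density_def)
  qed
  have "(\<integral>\<^sup>+y. ennreal (normal_density 0 d y) * ennreal (exp (a * y)) \<partial>lborel) =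
      (\<integral>\<^sup>+y. ennreal (exp (a\<^sup>2 * d\<^sup>2 / 2)) * ennreal (normal_density (a * d\<^sup>2) d y) \<partial>lborel)"
    by (simp add: ennreal_mult'[symmetric] sq)
  also have "\<dots> = ennreal (exp (a\<^sup>2 * d\<^sup>2 / 2)) * (\<integral>\<^sup>+y. ennreal (normal_density (a * d\<^sup>2) d y) \<partial>lborel)"
    by (rule nn_integral_cmult) simp
  also have "(\<integral>\<^sup>+y. ennreal (normal_density (a * d\<^sup>2) d y) \<partial>lborel) = 1"
    using prob_space.emeasure_space_1[OF prob_space_normal_density[OF d, of "a * d\<^sup>2"]]
    by (simp add: emeasure_density)
  finally show ?thesis by simp
qed

text \<open>
  The exponent uses \<open>x\<^sup>2 \<ge> u\<^sup>2 - 2 u r\<close> on the interval. This form holds for every radius, even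
  when the interval reaches zero, and stays integrable when \<open>r\<close> is replaced by a normal variable.
\<close>

lemma prob_normal_near_le:
  assumes S: "centred_normal M S v" and v: "v > 0" and r: "r \<ge> 0" and u: "u \<ge> 0"
  shows "measure (distr M borel S) {u - r..u + r} \<le> 2 * r / sqrt (2 * pi * v) * exp (- (u\<^sup>2 - 2 * u * r) / (2 * v))"
proof -
  have D: "distributed M lborel S (normal_density 0 (sqrt v))" using S v by (simp add: centred_normal_def)
  have [measurable]: "S \<in> borel_measurable M" using S by (rule centred_normal_measurable)
  let ?c = "1 / sqrt (2 * pi * v) * exp (- (u\<^sup>2 - 2 * u * r) / (2 * v))"
  have "ennreal (measure (distr M borel S) {u - r..u + r}) = emeasure M (S -` {u - r..u + r} \<inter> space M)"
    by (subst measure_distr) (auto simp: emeasure_eq_measure)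
  also have "\<dots> = (\<integral>\<^sup>+x. ennreal (normal_density 0 (sqrt v) x) * indicator {u - r..u + r} x \<partial>lborel)"
    by (rule distributed_emeasure[OF D]) simp
  also have "\<dots> \<le> (\<integral>\<^sup>+x. ennreal ?c * indicator {u - r..u + r} x \<partial>lborel)"
  proof (intro nn_integral_mono)
    fix x :: real
    have "normal_density 0 (sqrt v) x \<le> ?c" if "x \<in> {u - r..u + r}"
    proof -
      have "u\<^sup>2 - 2 * u * r \<le> u\<^sup>2 + 2 * u * (x - u)"
        using that u mult_left_mono[of "- r" "x - u" "2 * u"] by (simp add: algebra_simps)
      also have "\<dots> \<le> u\<^sup>2 + 2 * u * (x - u) + (x - u)\<^sup>2" by simp
      also have "\<dots> = x\<^sup>2" by (simp add: power2_eq_square algebra_simps)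
      finally have "- x\<^sup>2 / (2 * v) \<le> - (u\<^sup>2 - 2 * u * r) / (2 * v)"
        using v by (intro divide_right_mono) auto
      then show ?thesis unfolding normal_density_def using v by (auto intro!: mult_left_mono divide_right_mono)
    qed
    then show "ennreal (normal_density 0 (sqrt v) x) * indicator {u - r..u + r} x \<le> ennreal ?c * indicator {u - r..u + r} x"
      by (auto split: split_indicator intro!: ennreal_leI)
  qed
  also have "\<dots> = ennreal (?c * (2 * r))"
  proof -
    have "emeasure lborel {u - r..u + r} = ennreal (2 * r)" using r by (subst emeasure_lborel_Icc) auto
    then have "(\<integral>\<^sup>+x. ennreal ?c * indicator {u - r..u + r} x \<partial>lborel) = ennreal ?c * ennreal (2 * r)"
      by (metis nn_integral_cmult_indicator atLeastAtMost_borel sets_lborel)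
    also have "\<dots> = ennreal (?c * (2 * r))" using r v by (intro ennreal_mult[symmetric]) auto
    finally show ?thesis .
  qed
  finally show ?thesis using r v by (subst (asm) ennreal_le_iff) (auto simp: mult_ac)
qed

text \<open>
  A discrete substitute for Rice's formula. The mean \<open>S\<close> and the increment \<open>D\<close> of the two
  variables are independent, and a crossing of \<open>u\<close> forces \<open>D > 0\<close> and \<open>S\<close> within \<open>D / 2\<close> of \<open>u\<close>.
  Given \<open>D\<close> this has probability of order \<open>D exp (- u\<^sup>2 / 2)\<close>, so the total is of the order of
  the standard deviation \<open>d\<close> of the increment. For a smooth process \<open>d\<close> is at most a multiple of
  the spacing, hence the sum over a grid stays bounded as the grid is refined.
\<close>

lemma prob_upcrossing_le:
  assumes normal: "\<And>a b. centred_normal M (\<lambda>\<omega>. a * X \<omega> + b * Y \<omega>) (a\<^sup>2 + b\<^sup>2 + 2 * a * b * r)"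
    and d: "d > 0" and r: "r = 1 - d\<^sup>2 / 2" and small: "d \<le> 1" "u * d \<le> 1" and u: "u \<ge> 0"
  shows "prob {\<omega> \<in> space M. X \<omega> \<le> u \<and> u < Y \<omega>} \<le> exp 2 * d * exp (- u\<^sup>2 / 2)"
proof -
  define S where "S = (\<lambda>\<omega>. (X \<omega> + Y \<omega>) / 2)"
  define D where "D = (\<lambda>\<omega>. Y \<omega> - X \<omega>)"
  define v where "v = 1 - d\<^sup>2 / 4"
  have "d\<^sup>2 \<le> 1" using d small(1) by (simp add: power_le_one)
  then have v: "1 / 2 \<le> v" "v \<le> 1" unfolding v_def by simp_all
  have SD: "centred_normal M (\<lambda>\<omega>. a * S \<omega> + b * D \<omega>) (a\<^sup>2 * v + b\<^sup>2 * d\<^sup>2)" for a b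
  proof -
    have "(\<lambda>\<omega>. a * S \<omega> + b * D \<omega>) = (\<lambda>\<omega>. (a / 2 - b) * X \<omega> + (a / 2 + b) * Y \<omega>)"
      by (auto simp: S_def D_def field_simps)
    moreover have "a\<^sup>2 * v + b\<^sup>2 * d\<^sup>2 = (a / 2 - b)\<^sup>2 + (a / 2 + b)\<^sup>2 + 2 * (a / 2 - b) * (a / 2 + b) * r"
      unfolding r v_def by (simp add: field_simps power2_eq_square)
    ultimately show ?thesis using normal[of "a / 2 - b" "a / 2 + b"] by simp
  qed
  have S: "centred_normal M S v" using SD[of 1 0] by simp
  have D: "centred_normal M D (d\<^sup>2)" using SD[of 0 1] by simp
  have Dd: "distributed M lborel D (normal_density 0 d)" using D d by (simp add: centred_normal_def)
  have [measurable]: "S \<in> borel_measurable M" "D \<in> borel_measurable M"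
    using S D centred_normal_measurable by blast+
  have "indep_var borel S borel D"
    using SD v by (intro indep_var_centred_normal) auto
  then have joint: "distr M borel S \<Otimes>\<^sub>M distr M borel D = distr M (borel \<Otimes>\<^sub>M borel) (\<lambda>\<omega>. (S \<omega>, D \<omega>))"
    unfolding indep_var_distribution_eq by blast
  interpret S: prob_space "distr M borel S" by (rule prob_space_distr) simp
  interpret D: prob_space "distr M borel D" by (rule prob_space_distr) simp
  interpret SD: pair_sigma_finite "distr M borel S" "distr M borel D" ..
  define A where "A = {p :: real \<times> real. snd p > 0 \<and> u - snd p / 2 \<le> fst p \<and> fst p \<le> u + snd p / 2}"
  have "{p \<in> space (borel \<Otimes>\<^sub>M borel). snd p > 0 \<and> u - snd p / 2 \<le> fst p \<and> fst p \<le> u + snd p / 2} \<in> sets (borel \<Otimes>\<^sub>M borel)"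
    by measurable
  then have [measurable]: "A \<in> sets (borel \<Otimes>\<^sub>M borel)" by (simp add: A_def space_pair_measure)
  have A': "A \<in> sets (distr M borel S \<Otimes>\<^sub>M distr M borel D)"
    by (simp cong: sets_pair_measure_cong)
  define c where "c = d / sqrt (2 * pi * v) * exp (- u\<^sup>2 / (2 * v))"
  have c0: "0 \<le> c" using d v by (simp add: c_def)
  let ?a = "u / (2 * v) + 1 / d"
  have "ennreal (prob {\<omega> \<in> space M. X \<omega> \<le> u \<and> u < Y \<omega>}) \<le> emeasure M ((\<lambda>\<omega>. (S \<omega>, D \<omega>)) -` A \<inter> space M)"
    unfolding emeasure_eq_measure[symmetric]
  proof (rule emeasure_mono)
    show "{\<omega> \<in> space M. X \<omega> \<le> u \<and> u < Y \<omega>} \<subseteq> (\<lambda>\<omega>. (S \<omega>, D \<omega>)) -` A \<inter> space M"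
      by (auto simp: A_def S_def D_def field_simps)
    show "(\<lambda>\<omega>. (S \<omega>, D \<omega>)) -` A \<inter> space M \<in> events"
      by (rule measurable_sets[of _ _ "borel \<Otimes>\<^sub>M borel"]) auto
  qed
  also have "\<dots> = emeasure (distr M borel S \<Otimes>\<^sub>M distr M borel D) A"
    unfolding joint by (rule emeasure_distr[symmetric]) auto
  also have "\<dots> = (\<integral>\<^sup>+y. emeasure (distr M borel S) ((\<lambda>x. (x, y)) -` A) \<partial>distr M borel D)"
    by (rule SD.emeasure_pair_measure_alt2[OF A'])
  also have "\<dots> \<le> (\<integral>\<^sup>+y. ennreal (c * exp (?a * y)) \<partial>distr M borel D)"
  proof (intro nn_integral_mono)
    fix y :: real
    show "emeasure (distr M borel S) ((\<lambda>x. (x, y)) -` A) \<le> ennreal (c * exp (?a * y))"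
    proof (cases "y > 0")
      case True
      have "emeasure (distr M borel S) ((\<lambda>x. (x, y)) -` A) = measure (distr M borel S) {u - y / 2..u + y / 2}"
        unfolding S.emeasure_eq_measure by (rule arg_cong[where f = "\<lambda>B. ennreal (measure _ B)"])
           (use True in \<open>auto simp: A_def\<close>)
      also have "measure (distr M borel S) {u - y / 2..u + y / 2} \<le>
          2 * (y / 2) / sqrt (2 * pi * v) * exp (- (u\<^sup>2 - 2 * u * (y / 2)) / (2 * v))"
        using True v u S by (intro prob_normal_near_le) auto
      also have "\<dots> = y / sqrt (2 * pi * v) * (exp (- u\<^sup>2 / (2 * v)) * exp (u / (2 * v) * y))"
        unfolding exp_add[symmetric] using v by (simp add: field_simps)
      also have "\<dots> \<le> (d * exp (y / d)) / sqrt (2 * pi * v) * (exp (- u\<^sup>2 / (2 * v)) * exp (u / (2 * v) * y))"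
      proof (intro mult_right_mono divide_right_mono)
        \<comment> \<open>Trading the factor \<open>y\<close> for an exponential reduces the integral to a moment generating function.\<close>
        have "y / d \<le> exp (y / d)" using exp_ge_add_one_self[of "y / d"] by linarith
        then show "y \<le> d * exp (y / d)" using d by (simp add: field_simps)
      qed (use v in auto)
      also have "\<dots> = c * exp (?a * y)"
        by (simp add: c_def ring_distribs exp_add)
      finally show ?thesis by (simp add: ennreal_leI)
    next
      case False
      then have "(\<lambda>x. (x, y)) -` A = {}" by (auto simp: A_def)
      then show ?thesis by simp
    qed
  qed
  also have "\<dots> = (\<integral>\<^sup>+y. ennreal (normal_density 0 d y) * ennreal (c * exp (?a * y)) \<partial>lborel)"
    using distributed_nn_integral[OF Dd, of "\<lambda>y. ennreal (c * exp (?a * y))"]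
    by (subst nn_integral_distr) auto
  also have "\<dots> = (\<integral>\<^sup>+y. ennreal c * (ennreal (normal_density 0 d y) * ennreal (exp (?a * y))) \<partial>lborel)"
    using c0 by (intro nn_integral_cong) (simp add: ennreal_mult' mult_ac)
  also have "\<dots> = ennreal c * (\<integral>\<^sup>+y. ennreal (normal_density 0 d y) * ennreal (exp (?a * y)) \<partial>lborel)"
    by (rule nn_integral_cmult) simp
  also have "\<dots> = ennreal (c * exp (?a\<^sup>2 * d\<^sup>2 / 2))"
    unfolding nn_integral_normal_exp[OF d] using c0 by (simp add: ennreal_mult')
  also have "\<dots> \<le> ennreal ((d * exp (- u\<^sup>2 / 2)) * exp 2)"
  proof (intro ennreal_leI mult_mono)
    have "u / (2 * v) \<le> u" using v u by (simp add: divide_le_eq mult_left_mono[of 1 "2 * v" u, simplified])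
    then have "u / (2 * v) * d \<le> u * d" using d by (intro mult_right_mono) auto
    then have "?a * d \<le> 2" using small d by (simp add: ring_distribs)
    moreover have "0 \<le> ?a * d" using u v d by simp
    ultimately have "(?a * d)\<^sup>2 \<le> 2\<^sup>2" by (rule power_mono)
    then show "exp (?a\<^sup>2 * d\<^sup>2 / 2) \<le> exp 2" by (simp add: power_mult_distrib)
    have "1 \<le> 2 * pi * v" using v pi_gt3 mult_mono[of 3 pi "1/2" v] by simp
    then have "d / sqrt (2 * pi * v) \<le> d" using d v by (simp add: divide_le_eq)
    moreover have "exp (- u\<^sup>2 / (2 * v)) \<le> exp (- u\<^sup>2 / 2)"
    proof -
      have "u\<^sup>2 / 2 \<le> u\<^sup>2 / (2 * v)" using v by (intro divide_left_mono) auto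
      then show ?thesis by simp
    qed
    ultimately show "c \<le> d * exp (- u\<^sup>2 / 2)"
      unfolding c_def using d v by (intro mult_mono) auto
  qed (use d in auto)
  finally show ?thesis using d by (simp add: ennreal_le_iff mult_ac)
qed

text \<open>
  Both variables exceeding \<open>u\<close> forces their sum to exceed \<open>2 u\<close>. For strongly correlated
  variables nothing of the right order is lost, and the last factor is what makes clusters of
  exceedances along a grid of bounded mean size.
\<close>

lemma prob_both_exceed_le:
  assumes normal: "\<And>a b. centred_normal M (\<lambda>\<omega>. a * X \<omega> + b * Y \<omega>) (a\<^sup>2 + b\<^sup>2 + 2 * a * b * r)"
    and u: "u \<ge> 1"
  shows "prob {\<omega> \<in> space M. X \<omega> > u \<and> Y \<omega> > u} \<le> 2 * normal_tail u * exp (- u\<^sup>2 * (1 - r) / 4)"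
proof -
  have r: "- 1 \<le> r" "r \<le> 1"
    using centred_normal_variance_nonneg[OF normal[of 1 1]] centred_normal_variance_nonneg[OF normal[of 1 "- 1"]] by simp_all
  have Z: "centred_normal M (\<lambda>\<omega>. X \<omega> + Y \<omega>) (2 * (1 + r))" using normal[of 1 1] by (simp add: algebra_simps)
  have [measurable]: "X \<in> borel_measurable M" "Y \<in> borel_measurable M"
    using centred_normal_measurable[OF normal[of 1 0]] centred_normal_measurable[OF normal[of 0 1]] by simp_all
  have "prob {\<omega> \<in> space M. X \<omega> > u \<and> Y \<omega> > u} \<le> prob {\<omega> \<in> space M. X \<omega> + Y \<omega> > 2 * u}"
    by (intro finite_measure_mono) auto
  also have "\<dots> \<le> 2 * normal_tail u * exp (- u\<^sup>2 * (1 - r) / 4)"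
  proof (cases "r = - 1")
    case True
    then have "AE \<omega> in M. X \<omega> + Y \<omega> = 0" using Z by (simp add: centred_normal_def)
    then have "prob {\<omega> \<in> space M. X \<omega> + Y \<omega> > 2 * u} = 0"
      using u by (subst measure_eq_0_null_sets) (auto simp: AE_iff_null_sets elim!: eventually_mono)
    then show ?thesis by (simp add: normal_tail_def)
  next
    case False
    then have r1: "1 + r > 0" using r by simp
    define q where "q = 2 * u / sqrt (2 * (1 + r))"
    have "q\<^sup>2 = (4 * u\<^sup>2) / (2 * (1 + r))" using r1 by (simp add: q_def power_divide power_mult_distrib)
    also have "\<dots> = 2 * u\<^sup>2 / (1 + r)" using r1 by (simp add: divide_simps)
    finally have q2: "q\<^sup>2 = 2 * u\<^sup>2 / (1 + r)" .
    have "u\<^sup>2 \<le> q\<^sup>2" unfolding q2 using r r1 u mult_left_mono[of "1 + r" 2 "u\<^sup>2"] by (simp add: le_divide_eq)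
    moreover have "0 \<le> q" using u r1 unfolding q_def by (intro divide_nonneg_nonneg) auto
    ultimately have qu: "u \<le> q" by (rule power2_le_imp_le)
    have "prob {\<omega> \<in> space M. X \<omega> + Y \<omega> > 2 * u} = normal_tail q"
      unfolding q_def using prob_centred_normal_greater[OF Z] r1 by simp
    also have "\<dots> \<le> std_normal_density q / q" using qu u by (intro normal_tail_le) auto
    also have "\<dots> \<le> std_normal_density q / u" using qu u by (intro divide_left_mono) auto
    also have "\<dots> \<le> (std_normal_density u / u) * exp (- u\<^sup>2 * (1 - r) / 4)"
    proof -
      have "u\<^sup>2 / 2 + u\<^sup>2 * (1 - r) / 4 \<le> q\<^sup>2 / 2"
      proof -
        \<comment> \<open>The difference of the two sides is \<open>(1 - r)\<^sup>2 / 4\<close>.\<close>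
        have "(1 / 2 + (1 - r) / 4) * (1 + r) \<le> 1"
          using zero_le_square[of "1 - r"] by (simp add: field_simps)
        then have "1 / 2 + (1 - r) / 4 \<le> 1 / (1 + r)" using r1 by (simp add: le_divide_eq)
        moreover have "q\<^sup>2 / 2 = u\<^sup>2 * (1 / (1 + r))" unfolding q2 using r1 by (simp add: divide_simps)
        moreover have "u\<^sup>2 / 2 + u\<^sup>2 * (1 - r) / 4 = u\<^sup>2 * (1 / 2 + (1 - r) / 4)" by (simp add: algebra_simps)
        ultimately show ?thesis by (simp only: mult_left_mono zero_le_power2)
      qed
      then have "- q\<^sup>2 / 2 \<le> - u\<^sup>2 / 2 + - u\<^sup>2 * (1 - r) / 4" by linarith
      then have "exp (- q\<^sup>2 / 2) \<le> exp (- u\<^sup>2 / 2) * exp (- u\<^sup>2 * (1 - r) / 4)"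
        unfolding exp_add[symmetric] by (simp only: exp_le_cancel_iff)
      then have "std_normal_density q \<le> std_normal_density u * exp (- u\<^sup>2 * (1 - r) / 4)"
        unfolding std_normal_density_def by (simp add: divide_right_mono)
      from divide_right_mono[OF this, of u] show ?thesis using u by simp
    qed
    also have "\<dots> \<le> (2 * normal_tail u) * exp (- u\<^sup>2 * (1 - r) / 4)"
      using normal_tail_ge[OF u] by (intro mult_right_mono) simp_all
    finally show ?thesis .
  qed
  finally show ?thesis .
qed

text \<open>
  For weakly correlated variables the bound through the sum loses a factor \<open>u\<close>, so one conditions
  instead: \<open>Z = Y - r X\<close> is independent of \<open>X\<close>, and unless \<open>X\<close> exceeds even \<open>2 u\<close>, the variable
  \<open>Z\<close> must exceed \<open>u - 2 \<bar>r\<bar> u\<close>.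
\<close>

lemma prob_both_exceed_weakly_correlated_le:
  assumes normal: "\<And>a b. centred_normal M (\<lambda>\<omega>. a * X \<omega> + b * Y \<omega>) (a\<^sup>2 + b\<^sup>2 + 2 * a * b * r)"
    and r: "\<bar>r\<bar> \<le> 1 / 2" and u: "u \<ge> 0"
  shows "prob {\<omega> \<in> space M. X \<omega> > u \<and> Y \<omega> > u} \<le>
    normal_tail (2 * u) + normal_tail u * normal_tail (u - 2 * \<bar>r\<bar> * u)"
proof -
  define Z where "Z = (\<lambda>\<omega>. Y \<omega> - r * X \<omega>)"
  have r2: "r\<^sup>2 < 1" using r by (simp add: abs_square_less_1)
  have XZ: "centred_normal M (\<lambda>\<omega>. a * X \<omega> + b * Z \<omega>) (a\<^sup>2 * 1 + b\<^sup>2 * (1 - r\<^sup>2))" for a b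
  proof -
    have "(\<lambda>\<omega>. a * X \<omega> + b * Z \<omega>) = (\<lambda>\<omega>. (a - b * r) * X \<omega> + b * Y \<omega>)"
      by (auto simp: Z_def algebra_simps)
    moreover have "a\<^sup>2 * 1 + b\<^sup>2 * (1 - r\<^sup>2) = (a - b * r)\<^sup>2 + b\<^sup>2 + 2 * (a - b * r) * b * r"
      by (simp add: algebra_simps power2_eq_square)
    ultimately show ?thesis using normal[of "a - b * r" b] by simp
  qed
  have X: "centred_normal M X 1" using XZ[of 1 0] by simp
  have Z: "centred_normal M Z (1 - r\<^sup>2)" using XZ[of 0 1] by simp
  have [measurable]: "X \<in> borel_measurable M" "Y \<in> borel_measurable M" "Z \<in> borel_measurable M"
    using centred_normal_measurable[OF normal[of 1 0]] centred_normal_measurable[OF normal[of 0 1]]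
      centred_normal_measurable[OF Z] by simp_all
  have indep: "indep_var borel X borel Z" 
    using XZ r2 by (intro indep_var_centred_normal[where p = 1 and q = "1 - r\<^sup>2"]) auto
  let ?w = "u - 2 * \<bar>r\<bar> * u"
  have w: "?w \<ge> 0" using r u mult_right_mono[of "2 * \<bar>r\<bar>" 1 u] by simp
  have "prob {\<omega> \<in> space M. X \<omega> > u \<and> Y \<omega> > u} \<le>
      prob ({\<omega> \<in> space M. X \<omega> > 2 * u} \<union> {\<omega> \<in> space M. X \<omega> \<in> {u<..} \<and> Z \<omega> \<in> {?w<..}})"
  proof (intro finite_measure_mono subsetI)
    fix \<omega> assume \<omega>: "\<omega> \<in> {\<omega> \<in> space M. X \<omega> > u \<and> Y \<omega> > u}"
    show "\<omega> \<in> {\<omega> \<in> space M. X \<omega> > 2 * u} \<union> {\<omega> \<in> space M. X \<omega> \<in> {u<..} \<and> Z \<omega> \<in> {?w<..}}"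
    proof (cases "X \<omega> > 2 * u")
      case False
      have "r * X \<omega> \<le> \<bar>r\<bar> * (2 * u)" using False \<omega> u by (intro mult_mono) auto
      then show ?thesis using \<omega> by (auto simp: Z_def)
    qed (use \<omega> in auto)
  qed auto
  also have "\<dots> \<le> prob {\<omega> \<in> space M. X \<omega> > 2 * u} + prob {\<omega> \<in> space M. X \<omega> \<in> {u<..} \<and> Z \<omega> \<in> {?w<..}}"
    by (rule measure_Un_le) auto
  also have "prob {\<omega> \<in> space M. X \<omega> \<in> {u<..} \<and> Z \<omega> \<in> {?w<..}} =
      prob {\<omega> \<in> space M. X \<omega> \<in> {u<..}} * prob {\<omega> \<in> space M. Z \<omega> \<in> {?w<..}}"
    by (rule prob_indep_random_variable[OF indep]) auto
  also have "prob {\<omega> \<in> space M. X \<omega> > 2 * u} = normal_tail (2 * u)"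
    using prob_centred_normal_greater[OF X] by simp
  also have "prob {\<omega> \<in> space M. X \<omega> \<in> {u<..}} = normal_tail u"
    using prob_centred_normal_greater[OF X, of u] by simp
  also have "prob {\<omega> \<in> space M. Z \<omega> \<in> {?w<..}} = normal_tail (?w / sqrt (1 - r\<^sup>2))"
    using prob_centred_normal_greater[OF Z, of ?w] r2 by simp
  also have "normal_tail u * normal_tail (?w / sqrt (1 - r\<^sup>2)) \<le> normal_tail u * normal_tail ?w"
  proof (intro mult_left_mono normal_tail_mono)
    have "sqrt (1 - r\<^sup>2) \<le> 1" "sqrt (1 - r\<^sup>2) > 0" using r2 by auto
    \<comment> \<open>Dividing a nonnegative threshold by a standard deviation at most one only raises it.\<close>
    then show "?w \<le> ?w / sqrt (1 - r\<^sup>2)" using w mult_left_mono[of "sqrt (1 - r\<^sup>2)" 1 ?w] by (simp add: le_divide_eq)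
  qed (simp add: normal_tail_def)
  finally show ?thesis by simp
qed

end

section \<open>Exceedances of continuous functions\<close>

lemma C2_smooth_imp_continuous: "C2_smooth f \<Longrightarrow> continuous_on UNIV f"
  unfolding C2_smooth_def by (meson DERIV_isCont continuous_at_imp_continuous_on)

lemma exceeding_point_nearby:
  fixes f :: "real \<Rightarrow> real"
  assumes "continuous_on UNIV f" "f t > u"
  obtains \<delta> where "\<delta> > 0" "\<And>x. \<bar>x - t\<bar> < \<delta> \<Longrightarrow> f x > u"
proof -
  have "isCont f t" using assms(1) by (simp add: continuous_on_eq_continuous_at)
  then have "\<exists>\<delta>>0. \<forall>x. dist x t < \<delta> \<longrightarrow> dist (f x) (f t) < f t - u"
    using assms(2) unfolding continuous_at_eps_delta by simp
  then obtain \<delta> where \<delta>: "\<delta> > 0" "\<And>x. dist x t < \<delta> \<Longrightarrow> dist (f x) (f t) < f t - u" by blast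
  show thesis
  proof (rule that[OF \<delta>(1)])
    fix x assume "\<bar>x - t\<bar> < \<delta>"
    then have "\<bar>f x - f t\<bar> < f t - u" using \<delta>(2)[of x] by (simp add: dist_real_def)
    then show "f x > u" by linarith
  qed
qed

lemma exceeds_at_rational:
  fixes f :: "real \<Rightarrow> real"
  assumes f: "continuous_on UNIV f" and "R > 0" "t \<in> {0..R}" "f t > u"
  obtains q where "q \<in> \<rat>" "q \<in> {0..R}" "f q > u"
proof -
  obtain \<delta> where \<delta>: "\<delta> > 0" "\<And>x. \<bar>x - t\<bar> < \<delta> \<Longrightarrow> f x > u"
    using exceeding_point_nearby[of f u t] assms by metis
  have "max 0 (t - \<delta>) < min R (t + \<delta>)" using assms \<delta>(1) by auto
  then obtain q where "q \<in> \<rat>" "max 0 (t - \<delta>) < q" "q < min R (t + \<delta>)"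
    using Rats_dense_in_real by blast
  then show thesis using that[of q] \<delta>(2)[of q] by auto
qed

text \<open>
  The grids \<open>k R / 2^m\<close> refine each other and contain both endpoints, which makes the events of
  exceeding on them an increasing sequence.
\<close>

lemma exceeds_at_dyadic:
  fixes f :: "real \<Rightarrow> real"
  assumes f: "continuous_on UNIV f" and R: "R > 0" "t \<in> {0..R}" "f t > u"
  obtains m :: nat and k where "k \<le> 2 ^ m" "f (real k * (R / 2 ^ m)) > u"
proof -
  obtain \<delta> where \<delta>: "\<delta> > 0" "\<And>x. \<bar>x - t\<bar> < \<delta> \<Longrightarrow> f x > u"
    using exceeding_point_nearby[of f u t] assms by metis
  obtain m :: nat where m: "R / \<delta> < 2 ^ m" using real_arch_pow[of 2 "R / \<delta>"] by auto
  define h where "h = R / 2 ^ m"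
  have h: "h > 0" "h < \<delta>" using m R \<delta>(1) by (auto simp: h_def field_simps)
  define k where "k = nat \<lfloor>t / h\<rfloor>"
  have k: "real k = of_int \<lfloor>t / h\<rfloor>" using R h by (simp add: k_def)
  have "real k \<le> t / h" "t / h < real k + 1" unfolding k by linarith+
  then have kh: "real k * h \<le> t" "t < real k * h + h" using h by (simp_all add: field_simps)
  have "real k \<le> R / h" using kh(1) R h by (simp add: field_simps)
  also have "R / h = 2 ^ m" using R by (simp add: h_def)
  finally have "k \<le> 2 ^ m" by (metis of_nat_le_iff of_nat_numeral of_nat_power)
  moreover have "f (real k * h) > u" using kh h by (intro \<delta>(2)) auto
  ultimately show thesis using that unfolding h_def by blast
qed

section \<open>Stationary Gaussian processes with smooth paths\<close>

text \<open>
  The normalised form of the hypotheses: unit variance and correlation function \<open>\<rho>\<close>. Only the laws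
  of linear combinations of two values enter, and these are symmetric under a change of sign of the
  process, so that the statements about maxima also govern minima.
\<close>

locale smooth_stationary_gaussian = prob_space M for M :: "'a measure" +
  fixes X :: "'a \<Rightarrow> real \<Rightarrow> real" and \<rho> :: "real \<Rightarrow> real"
  assumes normal: "\<And>a b s t. centred_normal M (\<lambda>\<omega>. a * X \<omega> s + b * X \<omega> t) (a\<^sup>2 + b\<^sup>2 + 2 * a * b * \<rho> (t - s))"
    and smooth: "AE \<omega> in M. C2_smooth (X \<omega>)"
    and log_decay: "((\<lambda>t. \<rho> t * ln \<bar>t\<bar>) \<longlongrightarrow> 0) at_infinity"
begin

lemma measurable_X[measurable]: "(\<lambda>\<omega>. X \<omega> t) \<in> borel_measurable M"
  using centred_normal_measurable[OF normal[of 1 t 0 t]] by simp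

lemma standard_normal_X: "centred_normal M (\<lambda>\<omega>. X \<omega> t) 1"
  using normal[of 1 t 0 t] by simp

lemma prob_exceed_at: "prob {\<omega> \<in> space M. X \<omega> t > u} = normal_tail u"
  using prob_centred_normal_greater[OF standard_normal_X, of u t] by simp

lemma increment_normal: "centred_normal M (\<lambda>\<omega>. X \<omega> t - X \<omega> s) (2 * (1 - \<rho> (t - s)))"
  using normal[of "- 1" s 1 t] by simp

lemma \<rho>_le_1: "\<rho> t \<le> 1"
  using centred_normal_variance_nonneg[OF increment_normal[of t 0]] by simp

lemma \<rho>_0: "\<rho> 0 = 1"
  using centred_normal_second_moment(2)[OF increment_normal[of 0 0]] by simp

text \<open>
  The increment over \<open>2 t\<close> is the sum of two increments over \<open>t\<close> with the same variance.
\<close>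

lemma \<rho>_double: "1 - \<rho> (2 * t) \<le> 4 * (1 - \<rho> t)"
proof -
  note moment = centred_normal_second_moment[OF increment_normal]
  have "2 * (1 - \<rho> (2 * t)) = expectation (\<lambda>\<omega>. (X \<omega> (2 * t) - X \<omega> 0)\<^sup>2)"
    using moment(2)[of "2 * t" 0] by simp
  also have "\<dots> \<le> expectation (\<lambda>\<omega>. 2 * (X \<omega> (2 * t) - X \<omega> t)\<^sup>2 + 2 * (X \<omega> t - X \<omega> 0)\<^sup>2)"
  proof (rule integral_mono)
    fix \<omega>
    show "(X \<omega> (2 * t) - X \<omega> 0)\<^sup>2 \<le> 2 * (X \<omega> (2 * t) - X \<omega> t)\<^sup>2 + 2 * (X \<omega> t - X \<omega> 0)\<^sup>2"
      using zero_le_power2[of "(X \<omega> (2 * t) - X \<omega> t) - (X \<omega> t - X \<omega> 0)"]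
      by (simp add: power2_eq_square algebra_simps)
  qed (use moment(1) in auto)
  also have "\<dots> = 2 * (2 * (1 - \<rho> t)) + 2 * (2 * (1 - \<rho> t))"
    using moment[of "2 * t" t] moment[of t 0] by simp
  finally show ?thesis by simp
qed

lemma \<rho>_double_power: "1 - \<rho> (2 ^ n * t) \<le> 4 ^ n * (1 - \<rho> t)"
proof (induction n)
  case (Suc n)
  have "1 - \<rho> (2 ^ Suc n * t) \<le> 4 * (1 - \<rho> (2 ^ n * t))" using \<rho>_double[of "2 ^ n * t"] by (simp add: mult.assoc)
  also have "\<dots> \<le> 4 * (4 ^ n * (1 - \<rho> t))" using Suc by simp
  finally show ?case by simp
qed simp

lemma log_decay_bound:
  assumes "\<epsilon> > 0"
  obtains T where "T \<ge> 1" "\<And>t. \<bar>t\<bar> \<ge> T \<Longrightarrow> \<bar>\<rho> t\<bar> * ln \<bar>t\<bar> \<le> \<epsilon>"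
proof -
  have "eventually (\<lambda>t. dist (\<rho> t * ln \<bar>t\<bar>) 0 < \<epsilon>) at_infinity"
    by (rule tendstoD[OF log_decay assms])
  then obtain B where B: "\<And>t. B \<le> \<bar>t\<bar> \<Longrightarrow> \<bar>\<rho> t * ln \<bar>t\<bar>\<bar> < \<epsilon>"
    unfolding eventually_at_infinity by auto
  show thesis
  proof (rule that[of "max 1 B"])
    fix t :: real assume t: "max 1 B \<le> \<bar>t\<bar>"
    then have "ln \<bar>t\<bar> \<ge> 0" by (intro ln_ge_zero) auto
    then have "\<bar>\<rho> t\<bar> * ln \<bar>t\<bar> = \<bar>\<rho> t * ln \<bar>t\<bar>\<bar>" by (simp add: abs_mult)
    also have "\<dots> \<le> \<epsilon>" using B[of t] t by simp
    finally show "\<bar>\<rho> t\<bar> * ln \<bar>t\<bar> \<le> \<epsilon>" .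
  qed simp
qed

lemma \<rho>_small_far:
  assumes "\<epsilon> > 0"
  obtains T where "T \<ge> 1" "\<And>t. \<bar>t\<bar> \<ge> T \<Longrightarrow> \<bar>\<rho> t\<bar> \<le> \<epsilon>"
proof -
  obtain T where T: "T \<ge> 1" "\<And>t. \<bar>t\<bar> \<ge> T \<Longrightarrow> \<bar>\<rho> t\<bar> * ln \<bar>t\<bar> \<le> \<epsilon>"
    using log_decay_bound[OF assms] by blast
  show thesis
  proof (rule that[of "max T (exp 1)"])
    fix t :: real assume t: "max T (exp 1) \<le> \<bar>t\<bar>"
    have "\<bar>t\<bar> > 0" using t exp_gt_zero[of "1 :: real"] by linarith
    then have "1 \<le> ln \<bar>t\<bar>" using t by (subst ln_ge_iff) auto
    then have "\<bar>\<rho> t\<bar> * 1 \<le> \<bar>\<rho> t\<bar> * ln \<bar>t\<bar>" by (intro mult_left_mono) auto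
    also have "\<dots> \<le> \<epsilon>" using T(2)[of t] t by simp
    finally show "\<bar>\<rho> t\<bar> \<le> \<epsilon>" by simp
  qed (use T in simp)
qed

text \<open>
  Decay of \<open>\<rho>\<close> at infinity already forces a quadratic gap at the origin and excludes periods:
  repeated doubling of \<open>t\<close> ends in the region where \<open>\<rho> \<le> 1 / 2\<close>, and each doubling costs a
  factor four, the same factor by which \<open>t\<^sup>2\<close> grows.
\<close>

lemma \<rho>_quadratic_gap:
  obtains c where "c > 0" "\<And>t. c * min (t\<^sup>2) 1 \<le> 1 - \<rho> t"
proof -
  obtain T where T: "T \<ge> 1" "\<And>t. \<bar>t\<bar> \<ge> T \<Longrightarrow> \<bar>\<rho> t\<bar> \<le> 1 / 2"
    using \<rho>_small_far[of "1 / 2"] by auto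
  define c where "c = 1 / (8 * T\<^sup>2)"
  have T2: "T\<^sup>2 \<ge> 1" using T by simp
  have c: "c > 0" "c \<le> 1 / 2" using T2 by (auto simp: c_def divide_simps)
  have "c * min (t\<^sup>2) 1 \<le> 1 - \<rho> t" for t
  proof (cases "\<bar>t\<bar> \<ge> T")
    case True
    have "c * min (t\<^sup>2) 1 \<le> c * 1" using c by (intro mult_left_mono) auto
    then show ?thesis using c T(2)[OF True] by linarith
  next
    case False
    show ?thesis
    proof (cases "t = 0")
      case True then show ?thesis using \<rho>_le_1[of 0] by simp
    next
      case t0: False
      have "\<exists>n. T \<le> 2 ^ n * \<bar>t\<bar>"
      proof -
        obtain n where "T / \<bar>t\<bar> < 2 ^ n" using real_arch_pow[of 2 "T / \<bar>t\<bar>"] by auto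
        then show ?thesis using t0 by (auto simp: field_simps intro!: exI[of _ n])
      qed
      define n where "n = (LEAST n. T \<le> 2 ^ n * \<bar>t\<bar>)"
      have n: "T \<le> 2 ^ n * \<bar>t\<bar>" unfolding n_def by (rule LeastI_ex) fact
      have "n \<noteq> 0" using n False by (intro notI) auto
      then obtain k where k: "n = Suc k" by (cases n) auto
      have "\<not> T \<le> 2 ^ k * \<bar>t\<bar>" using not_less_Least[of k "\<lambda>n. T \<le> 2 ^ n * \<bar>t\<bar>"] k unfolding n_def by simp
      then have "2 ^ n * \<bar>t\<bar> \<le> 2 * T" unfolding k by simp
      then have "(2 ^ n * \<bar>t\<bar>)\<^sup>2 \<le> (2 * T)\<^sup>2" by (intro power_mono) auto
      moreover have "(2 ^ n :: real)\<^sup>2 = 4 ^ n" by (simp add: power2_eq_square power_mult_distrib[symmetric])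
      ultimately have n2: "4 ^ n * t\<^sup>2 \<le> 4 * T\<^sup>2" by (simp add: power_mult_distrib)
      have "1 / 2 \<le> 1 - \<rho> (2 ^ n * t)" using T(2)[of "2 ^ n * t"] n by (auto simp: abs_mult)
      also have "\<dots> \<le> 4 ^ n * (1 - \<rho> t)" by (rule \<rho>_double_power)
      finally have half: "1 / 2 \<le> 4 ^ n * (1 - \<rho> t)" .
      have "c * min (t\<^sup>2) 1 \<le> c * t\<^sup>2" using c by (intro mult_left_mono) auto
      also have "\<dots> \<le> 1 - \<rho> t"
      proof -
        have "4 ^ n * (c * t\<^sup>2) = c * (4 ^ n * t\<^sup>2)" by simp
        also have "\<dots> \<le> c * (4 * T\<^sup>2)" using n2 c by (intro mult_left_mono) auto
        also have "\<dots> = 1 / 2" using T by (simp add: c_def)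
        also note half
        finally show ?thesis by simp
      qed
      finally show ?thesis .
    qed
  qed
  with c(1) that show thesis by blast
qed

lemma increment_quotients_bounded:
  assumes h: "h \<longlonglongrightarrow> 0" "\<And>n. h n \<noteq> 0"
  shows "AE \<omega> in M. \<exists>A::nat. \<forall>n. \<bar>X \<omega> (h n) - X \<omega> 0\<bar> \<le> real A * \<bar>h n\<bar>"
  using smooth
proof eventually_elim
  case (elim \<omega>)
  then obtain D where D: "(X \<omega> has_real_derivative D) (at 0)" unfolding C2_smooth_def by blast
  have "((\<lambda>s. (X \<omega> (0 + s) - X \<omega> 0) / s) \<longlongrightarrow> D) (at 0)" using D by (simp add: DERIV_def)
  moreover have "filterlim h (at 0) sequentially" using h by (simp add: filterlim_at)
  ultimately have "(\<lambda>n. (X \<omega> (0 + h n) - X \<omega> 0) / h n) \<longlonglongrightarrow> D"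
    by (rule filterlim_compose)
  then have "Bseq (\<lambda>n. (X \<omega> (h n) - X \<omega> 0) / h n)" by (auto intro: convergent_imp_Bseq convergentI)
  then obtain B where B: "\<And>n. \<bar>(X \<omega> (h n) - X \<omega> 0) / h n\<bar> \<le> B" unfolding Bseq_def by auto
  obtain A :: nat where "B \<le> real A" using real_arch_simple by blast
  then have "\<bar>X \<omega> (h n) - X \<omega> 0\<bar> \<le> real A * \<bar>h n\<bar>" for n
    using B[of n] h(2)[of n] by (simp add: divide_le_eq) (meson abs_ge_zero mult_right_mono order.trans)
  then show ?case by blast
qed

text \<open>
  Smoothness of the paths bounds the second spectral moment. If the bound failed along some
  sequence \<open>h n\<close>, the difference quotients of the process along it would be normal with variances
  tending to infinity, so would leave every bounded interval with probability tending to one;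
  but they converge almost surely.
\<close>

lemma \<rho>_quadratic_bound:
  obtains C where "C > 0" "\<And>h. 1 - \<rho> h \<le> C * h\<^sup>2"
proof (rule ccontr)
  assume "\<not> thesis"
  with that have "\<not> (\<forall>h. 1 - \<rho> h \<le> C * h\<^sup>2)" if "C > 0" for C using \<open>C > 0\<close> by blast
  then have "\<forall>n::nat. \<exists>h. real (Suc n) * h\<^sup>2 < 1 - \<rho> h" by (metis of_nat_0_less_iff zero_less_Suc not_le)
  then obtain h where h: "\<And>n. real (Suc n) * (h n)\<^sup>2 < 1 - \<rho> (h n)" by metis
  have h0: "h n \<noteq> 0" for n using h[of n] \<rho>_0 by auto
  have \<rho>_ge: "- 1 \<le> \<rho> t" for t
    using centred_normal_variance_nonneg[OF normal[of 1 0 1 t]] by simp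
  have "\<bar>h n\<bar> \<le> sqrt (2 / real (Suc n))" for n
  proof -
    have "real (Suc n) * (h n)\<^sup>2 \<le> 2" using h[of n] \<rho>_ge[of "h n"] by linarith
    then have "(h n)\<^sup>2 \<le> 2 / real (Suc n)" by (simp add: field_simps)
    then show ?thesis using real_sqrt_le_mono by fastforce
  qed
  moreover have "(\<lambda>n. sqrt (2 / real (Suc n))) \<longlonglongrightarrow> 0" by real_asymp
  ultimately have lim: "h \<longlonglongrightarrow> 0" by (rule_tac Lim_null_comparison) auto
  define B where "B A = {\<omega> \<in> space M. \<forall>n. \<bar>X \<omega> (h n) - X \<omega> 0\<bar> \<le> real A * \<bar>h n\<bar>}" for A :: nat
  have [measurable]: "B A \<in> events" for A unfolding B_def by measurable
  have "incseq B"
  proof (intro incseq_SucI subsetI)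
    fix A \<omega> assume \<omega>: "\<omega> \<in> B A"
    have "real A * \<bar>h n\<bar> \<le> real (Suc A) * \<bar>h n\<bar>" for n by (intro mult_right_mono) auto
    with \<omega> show "\<omega> \<in> B (Suc A)" unfolding B_def by (blast intro: order.trans)
  qed
  then have "(\<lambda>A. prob (B A)) \<longlonglongrightarrow> prob (\<Union>A. B A)" by (intro finite_Lim_measure_incseq) auto
  also have "prob (\<Union>A. B A) = 1"
  proof (subst prob_eq_1)
    show "AE \<omega> in M. \<omega> \<in> (\<Union>A. B A)"
      using increment_quotients_bounded[OF lim h0] AE_space by eventually_elim (auto simp: B_def)
  qed auto
  finally have "eventually (\<lambda>A. prob (B A) > 0) sequentially" by (rule order_tendstoD) simp
  then obtain A where A: "prob (B A) > 0" by (auto simp: eventually_sequentially)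
  have "prob (B A) \<le> real A / sqrt (pi * real (Suc n))" for n
  proof -
    let ?v = "2 * (1 - \<rho> (h n - 0))"
    have v: "?v > 2 * (real (Suc n) * (h n)\<^sup>2)" using h[of n] by simp
    moreover have "2 * (real (Suc n) * (h n)\<^sup>2) > 0" using h0[of n] by simp
    ultimately have v0: "?v > 0" by linarith
    have "prob (B A) \<le> prob ((\<lambda>\<omega>. X \<omega> (h n) - X \<omega> 0) -` {0 - real A * \<bar>h n\<bar>..0 + real A * \<bar>h n\<bar>} \<inter> space M)"
    proof (rule finite_measure_mono)
      show "B A \<subseteq> (\<lambda>\<omega>. X \<omega> (h n) - X \<omega> 0) -` {0 - real A * \<bar>h n\<bar>..0 + real A * \<bar>h n\<bar>} \<inter> space M"
        by (auto simp: B_def abs_le_iff dest!: spec[of _ n])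
    qed measurable
    also have "\<dots> = measure (distr M borel (\<lambda>\<omega>. X \<omega> (h n) - X \<omega> 0)) {0 - real A * \<bar>h n\<bar>..0 + real A * \<bar>h n\<bar>}"
      by (subst measure_distr) auto
    also have "\<dots> \<le> 2 * (real A * \<bar>h n\<bar>) / sqrt (2 * pi * ?v)"
      using prob_normal_near_le[OF increment_normal[of "h n" 0] v0, of "real A * \<bar>h n\<bar>" 0] by simp
    also have "\<dots> \<le> 2 * (real A * \<bar>h n\<bar>) / sqrt (4 * (pi * real (Suc n)) * (h n)\<^sup>2)"
    proof (intro divide_left_mono real_sqrt_le_mono mult_pos_pos)
      show "4 * (pi * real (Suc n)) * (h n)\<^sup>2 \<le> 2 * pi * ?v"
        using mult_left_mono[OF less_imp_le[OF v], of "2 * pi"] by (simp only: mult_ac) simp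
      show "0 < sqrt (2 * pi * ?v)" using v0 by simp
      show "0 < sqrt (4 * (pi * real (Suc n)) * (h n)\<^sup>2)"
        using h0[of n] by (simp only: real_sqrt_gt_0_iff) (intro mult_pos_pos, auto)
    qed simp
    also have "\<dots> = real A / sqrt (pi * real (Suc n))"
      using h0[of n] by (simp add: real_sqrt_mult)
    finally show ?thesis .
  qed
  moreover have "(\<lambda>n. real A / sqrt (pi * real (Suc n))) \<longlonglongrightarrow> 0" by real_asymp
  ultimately have "prob (B A) \<le> 0" by (intro LIMSEQ_le_const) auto
  with A show False by simp
qed

text \<open>
  Rational times make the event measurable; on continuous paths they suffice.
\<close>

definition exceeds :: "real \<Rightarrow> real \<Rightarrow> 'a set" where
  "exceeds R u = {\<omega> \<in> space M. \<exists>t\<in>{0..R} \<inter> \<rat>. X \<omega> t > u}"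

lemma exceeds_measurable[measurable]: "exceeds R u \<in> events"
proof -
  have "countable ({0..R} \<inter> \<rat>)" by (simp add: countable_rat)
  then show ?thesis unfolding exceeds_def by measurable
qed

lemma exceeds_iff:
  assumes "continuous_on UNIV (X \<omega>)" "\<omega> \<in> space M" "R > 0"
  shows "\<omega> \<in> exceeds R u \<longleftrightarrow> (\<exists>t\<in>{0..R}. X \<omega> t > u)"
proof
  assume "\<exists>t\<in>{0..R}. X \<omega> t > u"
  then obtain t where "t \<in> {0..R}" "X \<omega> t > u" by blast
  from exceeds_at_rational[OF assms(1,3) this] obtain q where "q \<in> \<rat>" "q \<in> {0..R}" "X \<omega> q > u" .
  then show "\<omega> \<in> exceeds R u" using assms(2) by (auto simp: exceeds_def)
qed (auto simp: exceeds_def)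

text \<open>
  If the process exceeds \<open>u\<close> at some point of a grid, it does so at the origin or crosses \<open>u\<close>
  upwards between two neighbours. The spacing times the number of neighbours is \<open>R\<close>, so the union
  bound does not deteriorate as the dyadic grid is refined.
\<close>

lemma prob_exceeds_le:
  obtains K where "K > 0" "\<And>R u. R > 0 \<Longrightarrow> u \<ge> 0 \<Longrightarrow> prob (exceeds R u) \<le> normal_tail u + K * R * exp (- u\<^sup>2 / 2)"
proof -
  obtain C where C: "C > 0" "\<And>h. 1 - \<rho> h \<le> C * h\<^sup>2" using \<rho>_quadratic_bound by blast
  obtain c where c: "c > 0" "\<And>t. c * min (t\<^sup>2) 1 \<le> 1 - \<rho> t" using \<rho>_quadratic_gap by blast
  define K where "K = exp 2 * sqrt (2 * C)"
  have K: "K > 0" using C by (simp add: K_def)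
  have "prob (exceeds R u) \<le> normal_tail u + K * R * exp (- u\<^sup>2 / 2)" if R: "R > 0" and u: "u \<ge> 0" for R u
  proof -
    define p where "p m k = real k * (R / 2 ^ m)" for m k :: nat
    define F where "F m = {\<omega> \<in> space M. \<exists>k\<in>{..2 ^ m}. X \<omega> (p m k) > u}" for m :: nat
    have [measurable]: "F m \<in> events" for m unfolding F_def by measurable
    have "incseq F"
    proof (intro incseq_SucI subsetI)
      fix m \<omega> assume "\<omega> \<in> F m"
      then obtain k where "\<omega> \<in> space M" "k \<le> 2 ^ m" "X \<omega> (p m k) > u" by (auto simp: F_def)
      moreover have "p (Suc m) (2 * k) = p m k" by (simp add: p_def)
      ultimately show "\<omega> \<in> F (Suc m)" by (auto simp: F_def intro!: bexI[of _ "2 * k"])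
    qed
    then have lim: "(\<lambda>m. prob (F m)) \<longlonglongrightarrow> prob (\<Union>m. F m)" by (intro finite_Lim_measure_incseq) auto
    have "prob (exceeds R u) \<le> prob (\<Union>m. F m)"
    proof (rule finite_measure_mono_AE)
      show "AE \<omega> in M. \<omega> \<in> exceeds R u \<longrightarrow> \<omega> \<in> (\<Union>m. F m)"
        using smooth AE_space
      proof eventually_elim
        case (elim \<omega>)
        note cont = C2_smooth_imp_continuous[OF elim(1)]
        show ?case
        proof
          assume "\<omega> \<in> exceeds R u"
          then obtain t where "t \<in> {0..R}" "X \<omega> t > u" using exceeds_iff[OF cont elim(2) R] by blast
          from exceeds_at_dyadic[OF cont R this] show "\<omega> \<in> (\<Union>m. F m)"
            using elim(2) unfolding F_def p_def by (metis (mono_tags, lifting) UN_I UNIV_I atMost_iff mem_Collect_eq)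
        qed
      qed
    qed auto
    also have "\<dots> \<le> normal_tail u + K * R * exp (- u\<^sup>2 / 2)"
    proof (rule LIMSEQ_le_const2[OF lim])
      have "eventually (\<lambda>m::nat. sqrt (2 * C) * (R / 2 ^ m) \<le> 1 \<and> u * (sqrt (2 * C) * (R / 2 ^ m)) \<le> 1) sequentially"
      proof (intro eventually_conj)
        have "(\<lambda>m::nat. sqrt (2 * C) * (R / 2 ^ m)) \<longlonglongrightarrow> 0" by real_asymp
        from order_tendstoD(2)[OF this zero_less_one]
        show "eventually (\<lambda>m::nat. sqrt (2 * C) * (R / 2 ^ m) \<le> 1) sequentially"
          by eventually_elim (rule less_imp_le)
        have "(\<lambda>m::nat. u * (sqrt (2 * C) * (R / 2 ^ m))) \<longlonglongrightarrow> 0" by real_asymp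
        from order_tendstoD(2)[OF this zero_less_one]
        show "eventually (\<lambda>m::nat. u * (sqrt (2 * C) * (R / 2 ^ m)) \<le> 1) sequentially"
          by eventually_elim (rule less_imp_le)
      qed
      then obtain m0 :: nat where m0: "\<And>m. m \<ge> m0 \<Longrightarrow> sqrt (2 * C) * (R / 2 ^ m) \<le> 1"
        "\<And>m. m \<ge> m0 \<Longrightarrow> u * (sqrt (2 * C) * (R / 2 ^ m)) \<le> 1"
        unfolding eventually_sequentially by blast
      have "prob (F m) \<le> normal_tail u + K * R * exp (- u\<^sup>2 / 2)" if m: "m \<ge> m0" for m
      proof -
        define h where "h = R / 2 ^ m"
        have h: "h > 0" using R by (simp add: h_def)
        define d where "d = sqrt (2 * (1 - \<rho> h))"
        have "0 < c * min (h\<^sup>2) 1" using c h by simp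
        then have gap: "0 < 1 - \<rho> h" using c(2)[of h] by linarith
        have d: "d > 0" "\<rho> h = 1 - d\<^sup>2 / 2" using gap by (simp_all add: d_def field_simps)
        have "d \<le> sqrt (2 * (C * h\<^sup>2))" unfolding d_def using C(2)[of h] by (intro real_sqrt_le_mono) simp
        also have "\<dots> = sqrt (2 * C) * h" using h C by (simp add: real_sqrt_mult)
        finally have dh: "d \<le> sqrt (2 * C) * h" .
        have d1: "d \<le> 1" using m0(1)[OF m] dh unfolding h_def by linarith
        have du: "u * d \<le> 1" using m0(2)[OF m] mult_left_mono[OF dh u] unfolding h_def by linarith
        define G where "G k = {\<omega> \<in> space M. X \<omega> (p m k) \<le> u \<and> u < X \<omega> (p m (Suc k))}" for k
        have [measurable]: "G k \<in> events" for k unfolding G_def by measurable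
        have G: "prob (G k) \<le> exp 2 * d * exp (- u\<^sup>2 / 2)" for k
          unfolding G_def
        proof (rule prob_upcrossing_le[OF _ d d1 du u])
          have "p m (Suc k) - p m k = h" by (simp add: p_def h_def field_simps)
          then show "centred_normal M (\<lambda>\<omega>. a * X \<omega> (p m k) + b * X \<omega> (p m (Suc k))) (a\<^sup>2 + b\<^sup>2 + 2 * a * b * \<rho> h)" for a b
            using normal[of a "p m k" b "p m (Suc k)"] by simp
        qed
        have "F m \<subseteq> {\<omega> \<in> space M. X \<omega> 0 > u} \<union> (\<Union>k\<in>{..<2 ^ m}. G k)"
        proof
          fix \<omega> assume "\<omega> \<in> F m"
          then obtain k where k: "\<omega> \<in> space M" "k \<le> 2 ^ m" "X \<omega> (p m k) > u" by (auto simp: F_def)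
          show "\<omega> \<in> {\<omega> \<in> space M. X \<omega> 0 > u} \<union> (\<Union>k\<in>{..<2 ^ m}. G k)"
            using k(2,3)
          proof (induction k)
            case 0 then show ?case using k(1) by (simp add: p_def)
          next
            case (Suc k)
            show ?case
            proof (cases "X \<omega> (p m k) > u")
              case True then show ?thesis using Suc by simp
            next
              case False
              then have "\<omega> \<in> G k" using Suc k(1) by (simp add: G_def)
              then show ?thesis using Suc by auto
            qed
          qed
        qed
        then have "prob (F m) \<le> prob ({\<omega> \<in> space M. X \<omega> 0 > u} \<union> (\<Union>k\<in>{..<2 ^ m}. G k))"
          by (intro finite_measure_mono) auto
        also have "\<dots> \<le> prob {\<omega> \<in> space M. X \<omega> 0 > u} + prob (\<Union>k\<in>{..<2 ^ m}. G k)"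
          by (rule measure_Un_le) auto
        also have "prob (\<Union>k\<in>{..<2 ^ m}. G k) \<le> (\<Sum>k\<in>{..<2 ^ m}. prob (G k))"
          by (rule finite_measure_subadditive_finite) auto
        also have "\<dots> \<le> (\<Sum>k\<in>{..<2 ^ m :: nat}. exp 2 * d * exp (- u\<^sup>2 / 2))" by (intro sum_mono G)
        also have "\<dots> = 2 ^ m * (exp 2 * d * exp (- u\<^sup>2 / 2))" by simp
        also have "\<dots> \<le> 2 ^ m * (exp 2 * (sqrt (2 * C) * h) * exp (- u\<^sup>2 / 2))"
          using dh by (intro mult_left_mono mult_right_mono) auto
        also have "\<dots> = K * R * exp (- u\<^sup>2 / 2)" by (simp add: K_def h_def)
        finally show ?thesis by (simp add: prob_exceed_at)
      qed
      then show "\<exists>N. \<forall>m\<ge>N. prob (F m) \<le> normal_tail u + K * R * exp (- u\<^sup>2 / 2)" by blast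
    qed
    finally show ?thesis .
  qed
  with K that show thesis by blast
qed

end

section \<open>The maximum over a long interval\<close>

text \<open>
  The Gumbel scaling up to a bounded shift of \<open>x\<close>: at this height the expected number of clusters of
  exceedances in an interval of length \<open>R\<close> is of order \<open>exp (- x)\<close>.
\<close>

definition extreme_level :: "real \<Rightarrow> real \<Rightarrow> real" where
  "extreme_level R x = sqrt (2 * ln R) + x / sqrt (2 * ln R)"

text \<open>
  The second moment method for the number \<open>N\<close> of events that occur. Since \<open>N\<close> vanishes off the
  union \<open>U\<close>, the expectation of \<open>(N - l indicator U)\<^sup>2\<close> is a quadratic polynomial in \<open>l\<close> with
  leading coefficient the probability of \<open>U\<close>, and it is nonnegative.
\<close>

lemma (in prob_space) second_moment_lower_bound:
  fixes A :: "nat \<Rightarrow> 'a set"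
  assumes [measurable]: "\<And>k. A k \<in> events" and p: "\<And>k. prob (A k) = p" and pos: "real n * p > 0"
    and S: "(\<Sum>j<n. \<Sum>k<n. prob (A j \<inter> A k)) \<le> S"
  shows "(real n * p)\<^sup>2 / S \<le> prob (\<Union>k<n. A k)"
proof -
  define U where "U = (\<Union>k<n. A k)"
  have [measurable]: "U \<in> events" unfolding U_def by measurable
  define N where "N \<omega> = (\<Sum>k<n. indicator (A k) \<omega> :: real)" for \<omega>
  define m where "m = real n * p"
  have m: "m > 0" using pos by (simp add: m_def)
  have NU: "N \<omega> * indicator U \<omega> = N \<omega>" for \<omega>
    by (auto simp: N_def U_def split: split_indicator)
  have intI[simp, intro]: "integrable M (indicator B :: _ \<Rightarrow> real)" if "B \<in> events" for B
    using that by (intro integrable_real_indicator) (auto simp: emeasure_eq_measure)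
  have EN: "expectation N = m" unfolding N_def m_def using p
    by (subst Bochner_Integration.integral_sum) auto
  have N2: "(N \<omega>)\<^sup>2 = (\<Sum>j<n. \<Sum>k<n. indicator (A j \<inter> A k) \<omega>)" for \<omega>
    unfolding N_def power2_eq_square sum_product by (simp add: indicator_inter_arith)
  have EN2: "expectation (\<lambda>\<omega>. (N \<omega>)\<^sup>2) = (\<Sum>j<n. \<Sum>k<n. prob (A j \<inter> A k))"
    unfolding N2 by (subst Bochner_Integration.integral_sum; (subst Bochner_Integration.integral_sum)?) auto
  have intN: "integrable M N" unfolding N_def by auto
  have intN2: "integrable M (\<lambda>\<omega>. (N \<omega>)\<^sup>2)" unfolding N2 by auto
  have key: "0 \<le> S - 2 * l * m + l\<^sup>2 * prob U" for l
  proof -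
    have "0 \<le> expectation (\<lambda>\<omega>. (N \<omega> - l * indicator U \<omega>)\<^sup>2)" by simp
    also have "(\<lambda>\<omega>. (N \<omega> - l * indicator U \<omega>)\<^sup>2) = (\<lambda>\<omega>. (N \<omega>)\<^sup>2 - 2 * l * N \<omega> + l\<^sup>2 * indicator U \<omega>)"
    proof
      fix \<omega>
      have "(N \<omega> - l * indicator U \<omega>)\<^sup>2 = (N \<omega>)\<^sup>2 - 2 * l * (N \<omega> * indicator U \<omega>) + l\<^sup>2 * (indicator U \<omega>)\<^sup>2"
        by (simp add: power2_eq_square algebra_simps)
      then show "(N \<omega> - l * indicator U \<omega>)\<^sup>2 = (N \<omega>)\<^sup>2 - 2 * l * N \<omega> + l\<^sup>2 * indicator U \<omega>"
        unfolding NU by (auto split: split_indicator)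
    qed
    also have "expectation \<dots> = expectation (\<lambda>\<omega>. (N \<omega>)\<^sup>2) - 2 * l * m + l\<^sup>2 * prob U"
      using intN intN2 EN by simp
    also have "\<dots> \<le> S - 2 * l * m + l\<^sup>2 * prob U" using S EN2 by simp
    finally show ?thesis .
  qed
  have Spos: "S > 0"
  proof -
    have "0 \<le> S - 2 * m * m + m\<^sup>2 * prob U" by (rule key)
    also have "\<dots> \<le> S - 2 * m * m + m\<^sup>2 * 1" by (intro add_left_mono mult_left_mono) auto
    finally have "m\<^sup>2 \<le> S" by (simp add: power2_eq_square)
    then show ?thesis using m zero_less_power[of m 2] by linarith
  qed
  \<comment> \<open>This \<open>l\<close> turns the first two terms into \<open>- S\<close>.\<close>
  have "0 \<le> S - 2 * (S / m) * m + (S / m)\<^sup>2 * prob U" by (rule key)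
  then have "S \<le> (S / m)\<^sup>2 * prob U" using m by simp
  then have "m\<^sup>2 * S \<le> S * S * prob U" using m by (simp add: field_simps power2_eq_square)
  then show ?thesis using Spos unfolding U_def m_def by (simp add: field_simps power2_eq_square)
qed

lemma sum_geometric_distance_le:
  fixes q :: real assumes "0 \<le> q" "q < 1"
  shows "(\<Sum>k<n. q ^ nat \<bar>int k - int j\<bar>) \<le> 2 / (1 - q)"
proof -
  have geo: "(\<Sum>i\<in>I. q ^ i) \<le> 1 / (1 - q)" if "finite I" for I
    using sum_le_suminf[OF summable_geometric[of q] that] suminf_geometric[of q] assms by auto
  have "(\<Sum>k<n. q ^ nat \<bar>int k - int j\<bar>) \<le> (\<Sum>k\<in>{..j} \<union> {j<..<n}. q ^ nat \<bar>int k - int j\<bar>)"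
    using assms by (intro sum_mono2) auto
  also have "\<dots> = (\<Sum>k\<in>{..j}. q ^ nat \<bar>int k - int j\<bar>) + (\<Sum>k\<in>{j<..<n}. q ^ nat \<bar>int k - int j\<bar>)"
    by (rule sum.union_disjoint) auto
  also have "(\<Sum>k\<in>{..j}. q ^ nat \<bar>int k - int j\<bar>) = (\<Sum>i\<in>(\<lambda>k. j - k) ` {..j}. q ^ i)"
    by (subst sum.reindex) (auto simp: inj_on_def nat_diff_distrib' intro!: sum.cong arg_cong[where f = "\<lambda>i. q ^ i"])
  also have "\<dots> \<le> 1 / (1 - q)" by (rule geo) auto
  also have "(\<Sum>k\<in>{j<..<n}. q ^ nat \<bar>int k - int j\<bar>) = (\<Sum>i\<in>(\<lambda>k. k - j) ` {j<..<n}. q ^ i)"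
    by (subst sum.reindex) (auto simp: inj_on_def intro!: sum.cong arg_cong[where f = "\<lambda>i. q ^ i"])
  also have "\<dots> \<le> 1 / (1 - q)" by (rule geo) auto
  finally show ?thesis by simp
qed

lemma sum_indicator_distance_le:
  assumes "m \<ge> 0"
  shows "(\<Sum>k<n. indicator {..m} \<bar>real k - real j\<bar>) \<le> 2 * m + 1"
proof -
  have "(\<Sum>k<n. indicator {..m} \<bar>real k - real j\<bar> :: real) = real (card {k\<in>{..<n}. \<bar>real k - real j\<bar> \<le> m})"
  proof -
    have "(\<Sum>k<n. indicator {..m} \<bar>real k - real j\<bar> :: real) =
        (\<Sum>k<n. if \<bar>real k - real j\<bar> \<le> m then 1 else 0)"
      by (intro sum.cong) (auto split: split_indicator)
    also have "\<dots> = (\<Sum>k | k \<in> {..<n} \<and> \<bar>real k - real j\<bar> \<le> m. 1)"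
      by (rule sum.inter_filter[symmetric]) simp
    finally show ?thesis by simp
  qed
  also have "\<dots> \<le> real (card {int j - \<lfloor>m\<rfloor>..int j + \<lfloor>m\<rfloor>})"
  proof -
    have "int ` {k\<in>{..<n}. \<bar>real k - real j\<bar> \<le> m} \<subseteq> {int j - \<lfloor>m\<rfloor>..int j + \<lfloor>m\<rfloor>}"
      by (auto simp: abs_le_iff le_floor_iff algebra_simps) linarith+
    from card_mono[OF _ this] show ?thesis by (simp add: card_image)
  qed
  also have "\<dots> = 2 * of_int \<lfloor>m\<rfloor> + 1" using assms by simp
  also have "\<dots> \<le> 2 * m + 1" by linarith
  finally show ?thesis .
qed

context smooth_stationary_gaussian
begin

text \<open>
  The square of the level is at least \<open>2 ln R + 2 x\<close>, which cancels the length of the interval.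
\<close>

lemma prob_exceeds_extreme_level_le:
  obtains C where "C > 0" "\<And>x. eventually (\<lambda>R. prob (exceeds R (extreme_level R x)) \<le> C * exp (- x)) at_top"
proof -
  obtain K where K: "K > 0" "\<And>R u. R > 0 \<Longrightarrow> u \<ge> 0 \<Longrightarrow> prob (exceeds R u) \<le> normal_tail u + K * R * exp (- u\<^sup>2 / 2)"
    using prob_exceeds_le by blast
  have "eventually (\<lambda>R. prob (exceeds R (extreme_level R x)) \<le> (1 + K) * exp (- x)) at_top" for x
  proof -
    have "filterlim (\<lambda>R. extreme_level R x) at_top at_top"
      unfolding extreme_level_def by real_asymp
    then have "eventually (\<lambda>R. extreme_level R x \<ge> 1) at_top" by (simp add: filterlim_at_top)
    moreover have "eventually (\<lambda>R. R > (1 :: real)) at_top" by (rule eventually_gt_at_top)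
    ultimately show ?thesis
    proof eventually_elim
      case (elim R)
      define w where "w = sqrt (2 * ln R)"
      define u where "u = extreme_level R x"
      have w: "w > 0" "w\<^sup>2 / 2 = ln R" using elim by (simp_all add: w_def)
      have "u\<^sup>2 / 2 = w\<^sup>2 / 2 + x + (x / w)\<^sup>2 / 2"
        unfolding u_def extreme_level_def w_def[symmetric] using w(1) by (simp add: field_simps power2_eq_square)
      then have "u\<^sup>2 / 2 \<ge> ln R + x" using w(2) by simp
      then have "exp (- u\<^sup>2 / 2) \<le> exp (- (ln R + x))" by simp
      also have "\<dots> = exp (- x) / R" using elim by (simp add: exp_diff exp_minus field_simps)
      finally have e: "exp (- u\<^sup>2 / 2) \<le> exp (- x) / R" .
      have "prob (exceeds R u) \<le> normal_tail u + K * R * exp (- u\<^sup>2 / 2)"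
        using K(2)[of R u] elim by (simp add: u_def)
      also have "normal_tail u \<le> exp (- u\<^sup>2 / 2)" using elim by (intro normal_tail_le_exp) (simp add: u_def)
      also have "exp (- u\<^sup>2 / 2) + K * R * exp (- u\<^sup>2 / 2) \<le> exp (- x) / R + K * R * (exp (- x) / R)"
        using e elim K(1) by (intro add_mono mult_left_mono) auto
      also have "\<dots> \<le> exp (- x) + K * exp (- x)"
        using elim by (intro add_mono) (simp_all add: divide_le_eq)
      finally show ?case using elim unfolding u_def by (simp add: algebra_simps)
    qed
  qed
  with K(1) that[of "1 + K"] show thesis by simp
qed

text \<open>
  Here \<open>w\<close> stands for \<open>sqrt (2 ln R)\<close> and the grid has spacing \<open>1 / w\<close>. Pairs at distance beyond
  \<open>exp (\<epsilon> w\<^sup>2)\<close>, a small power of \<open>R\<close>, are so weakly correlated that they behave as if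
  independent. For closer pairs the quadratic gap of the correlation applies: within distance one it
  gives a geometric decay in the number of grid steps, and otherwise a probability that is smaller
  by a power of \<open>R\<close> which, for \<open>\<epsilon>\<close> small, beats the number of such pairs; the last conclusion says
  so.
\<close>

lemma prob_pair_exceeds_le:
  assumes "\<eta> > 0"
  obtains c \<epsilon> W where "c > 0" "\<epsilon> > 0" "W \<ge> 1"
    "\<And>w u j k. w \<ge> W \<Longrightarrow> w / 2 \<le> u \<Longrightarrow> u \<le> 2 * w \<Longrightarrow>
       prob {\<omega> \<in> space M. X \<omega> (real j / w) > u \<and> X \<omega> (real k / w) > u} \<le>
         (1 + \<eta>) * (normal_tail u)\<^sup>2 +
         2 * normal_tail u * (exp (- c) ^ nat \<bar>int k - int j\<bar>
            + exp (- c * w\<^sup>2) * indicator {..exp (\<epsilon> * w\<^sup>2) * w} \<bar>real k - real j\<bar>)"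
    "((\<lambda>w. exp (- c * w\<^sup>2) * (2 * (exp (\<epsilon> * w\<^sup>2) * w) + 1)) \<longlongrightarrow> 0) at_top"
proof -
  obtain c0 where c0: "c0 > 0" "\<And>t. c0 * min (t\<^sup>2) 1 \<le> 1 - \<rho> t" using \<rho>_quadratic_gap by blast
  obtain \<delta> U where \<delta>: "\<delta> > 0" "U \<ge> 1" "\<And>u r. u \<ge> U \<Longrightarrow> 0 \<le> r \<Longrightarrow> r * u\<^sup>2 \<le> \<delta> \<Longrightarrow>
      normal_tail (2 * u) + normal_tail u * normal_tail (u - 2 * r * u) \<le> (1 + \<eta>) * (normal_tail u)\<^sup>2"
    using weakly_correlated_tail_ratio[OF assms] by blast
  \<comment> \<open>The factors \<open>1 / 4\<close> come from the bound for the pair and from \<open>u \<ge> w / 2\<close>.\<close>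
  define c where "c = c0 / 16"
  \<comment> \<open>Any \<open>\<epsilon>\<close> below \<open>c\<close> would make the far part of the near pairs negligible.\<close>
  define \<epsilon> where "\<epsilon> = c / 2"
  have c: "c > 0" "\<epsilon> > 0" using c0 by (simp_all add: c_def \<epsilon>_def)
  obtain T1 where T1: "T1 \<ge> 1" "\<And>t. \<bar>t\<bar> \<ge> T1 \<Longrightarrow> \<bar>\<rho> t\<bar> * ln \<bar>t\<bar> \<le> \<delta> * \<epsilon> / 4"
    using log_decay_bound[of "\<delta> * \<epsilon> / 4"] \<delta> c by auto
  obtain T2 where T2: "T2 \<ge> 1" "\<And>t. \<bar>t\<bar> \<ge> T2 \<Longrightarrow> \<bar>\<rho> t\<bar> \<le> 1 / 2"
    using \<rho>_small_far[of "1 / 2"] by auto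
  have "filterlim (\<lambda>w::real. exp (\<epsilon> * w\<^sup>2)) at_top at_top" using c by real_asymp
  then have "eventually (\<lambda>w::real. exp (\<epsilon> * w\<^sup>2) \<ge> max T1 T2) at_top"
    unfolding filterlim_at_top by blast
  then obtain W0 where W0: "\<And>w. w \<ge> W0 \<Longrightarrow> exp (\<epsilon> * w\<^sup>2) \<ge> max T1 T2" unfolding eventually_at_top_linorder by blast
  define W where "W = max W0 (2 * U)"
  show thesis
  proof (rule that[of c \<epsilon> W])
    show "c > 0" "\<epsilon> > 0" by (fact c)+
    show "W \<ge> 1" using \<delta>(2) by (simp add: W_def)
    show "((\<lambda>w. exp (- c * w\<^sup>2) * (2 * (exp (\<epsilon> * w\<^sup>2) * w) + 1)) \<longlongrightarrow> 0) at_top"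
      unfolding \<epsilon>_def using c(1) by real_asymp
  next
    fix w u :: real and j k :: nat
    assume w: "w \<ge> W" and u: "w / 2 \<le> u" "u \<le> 2 * w"
    define t where "t = real k / w - real j / w"
    have wU: "w \<ge> 2 * U" "w > 0" using w \<delta>(2) by (auto simp: W_def)
    have u1: "u \<ge> U" "u \<ge> 1" using wU u \<delta>(2) by auto
    have tw: "\<bar>t\<bar> * w = \<bar>real k - real j\<bar>" using wU by (simp add: t_def diff_divide_distrib[symmetric])
    let ?P = "prob {\<omega> \<in> space M. X \<omega> (real j / w) > u \<and> X \<omega> (real k / w) > u}"
    let ?q = "normal_tail u"
    let ?g = "exp (- c) ^ nat \<bar>int k - int j\<bar>" 
    let ?I = "indicator {..exp (\<epsilon> * w\<^sup>2) * w} \<bar>real k - real j\<bar> :: real"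
    have q: "?q > 0" using u1 by (intro normal_tail_pos) auto
    have pair: "centred_normal M (\<lambda>\<omega>. a * X \<omega> (real j / w) + b * X \<omega> (real k / w)) (a\<^sup>2 + b\<^sup>2 + 2 * a * b * \<rho> t)" for a b
      unfolding t_def by (rule normal)
    have g: "?g = exp (- (c * \<bar>real k - real j\<bar>))"
    proof -
      have "real (nat \<bar>int k - int j\<bar>) = \<bar>real k - real j\<bar>" by simp
      then show ?thesis by (simp add: exp_of_nat_mult[symmetric] mult.commute)
    qed
    show "?P \<le> (1 + \<eta>) * ?q\<^sup>2 + 2 * ?q * (?g + exp (- c * w\<^sup>2) * ?I)"
    proof (cases "\<bar>t\<bar> \<le> exp (\<epsilon> * w\<^sup>2)")
      case True
      have I: "?I = 1" using mult_right_mono[OF True, of w] wU tw by simp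
      have uw: "w\<^sup>2 / 4 \<le> u\<^sup>2" using power_mono[OF u(1), of 2] wU by (simp add: power_divide)
      have "exp (- u\<^sup>2 * (1 - \<rho> t) / 4) \<le> ?g + exp (- c * w\<^sup>2)"
      proof (cases "\<bar>t\<bar> \<le> 1")
        case True
        then have "t\<^sup>2 \<le> 1" by (simp add: abs_square_le_1)
        then have "c0 * t\<^sup>2 \<le> 1 - \<rho> t" using c0(2)[of t] by simp
        then have "(w\<^sup>2 / 4) * (c0 * t\<^sup>2) \<le> u\<^sup>2 * (1 - \<rho> t)" using uw c0 by (intro mult_mono) auto
        moreover have "\<bar>real k - real j\<bar> \<le> (\<bar>t\<bar> * w)\<^sup>2"
        proof -
          have "real (nat \<bar>int k - int j\<bar>) \<le> (real (nat \<bar>int k - int j\<bar>))\<^sup>2"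
            by (metis of_nat_le_iff of_nat_power power2_eq_square le_square)
          then show ?thesis unfolding tw by simp
        qed
        then have "c * \<bar>real k - real j\<bar> \<le> c * (w\<^sup>2 * t\<^sup>2)"
          using c by (intro mult_left_mono) (auto simp: power_mult_distrib mult.commute)
        ultimately have "c * \<bar>real k - real j\<bar> \<le> u\<^sup>2 * (1 - \<rho> t) / 4" by (simp add: c_def mult.left_commute)
        then have "exp (- u\<^sup>2 * (1 - \<rho> t) / 4) \<le> ?g" unfolding g by simp
        then show ?thesis using exp_ge_zero[of "- c * w\<^sup>2"] by linarith
      next
        case False
        then have "c0 * 1 \<le> 1 - \<rho> t" using c0(2)[of t] by (simp add: abs_square_le_1[symmetric] min_def split: if_splits)
        then have "(w\<^sup>2 / 4) * (c0 * 1) \<le> u\<^sup>2 * (1 - \<rho> t)" using uw c0 by (intro mult_mono) auto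
        then have "exp (- u\<^sup>2 * (1 - \<rho> t) / 4) \<le> exp (- c * w\<^sup>2)" by (simp add: c_def mult.commute[of c0])
        then show ?thesis using zero_le_power[OF exp_ge_zero, of "- c" "nat \<bar>int k - int j\<bar>"] by linarith
      qed
      then have "2 * ?q * exp (- u\<^sup>2 * (1 - \<rho> t) / 4) \<le> 2 * ?q * (?g + exp (- c * w\<^sup>2) * ?I)"
        unfolding I using q by (intro mult_left_mono) auto
      moreover have "?P \<le> 2 * ?q * exp (- u\<^sup>2 * (1 - \<rho> t) / 4)"
        by (rule prob_both_exceed_le[OF pair u1(2)])
      moreover have "0 \<le> (1 + \<eta>) * ?q\<^sup>2" using assms by simp
      ultimately show ?thesis by linarith
    next
      case False
      then have t: "\<bar>t\<bar> \<ge> max T1 T2" "\<bar>t\<bar> > exp (\<epsilon> * w\<^sup>2)" using W0[of w] w by (auto simp: W_def)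
      have "\<bar>t\<bar> > 0" using t(2) exp_gt_zero[of "\<epsilon> * w\<^sup>2"] by linarith
      then have "\<epsilon> * w\<^sup>2 \<le> ln \<bar>t\<bar>" using t(2) by (subst ln_ge_iff) auto
      then have "\<bar>\<rho> t\<bar> * (\<epsilon> * w\<^sup>2) \<le> \<bar>\<rho> t\<bar> * ln \<bar>t\<bar>" by (intro mult_left_mono) auto
      also have "\<dots> \<le> \<delta> * \<epsilon> / 4" using T1(2)[of t] t by simp
      finally have "\<bar>\<rho> t\<bar> * (4 * w\<^sup>2) \<le> \<delta>" using c by (simp add: field_simps)
      moreover have "u\<^sup>2 \<le> 4 * w\<^sup>2" using power_mono[OF u(2), of 2] u1 by (simp add: power_mult_distrib)
      then have "\<bar>\<rho> t\<bar> * u\<^sup>2 \<le> \<bar>\<rho> t\<bar> * (4 * w\<^sup>2)" by (intro mult_left_mono) auto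
      ultimately have "\<bar>\<rho> t\<bar> * u\<^sup>2 \<le> \<delta>" by linarith
      then have "normal_tail (2 * u) + ?q * normal_tail (u - 2 * \<bar>\<rho> t\<bar> * u) \<le> (1 + \<eta>) * ?q\<^sup>2"
        using u1 by (intro \<delta>(3)) auto
      moreover have "?P \<le> normal_tail (2 * u) + ?q * normal_tail (u - 2 * \<bar>\<rho> t\<bar> * u)"
        using T2(2)[of t] t u1 by (intro prob_both_exceed_weakly_correlated_le[OF pair]) auto
      moreover have "0 \<le> 2 * ?q * (?g + exp (- c * w\<^sup>2) * ?I)"
        using q by (intro mult_nonneg_nonneg add_nonneg_nonneg) auto
      ultimately show ?thesis by linarith
    qed
  qed
qed

text \<open>
  The number of exceedances on the grid of spacing \<open>1 / w\<close> has mean \<open>m\<close> at least a constant times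
  \<open>exp (- x)\<close> and second moment at most \<open>(1 + \<eta>) m\<^sup>2 + K m\<close>, where the linear term accounts for
  clusters. The bound tends to \<open>1 / (1 + \<eta>)\<close> as \<open>x\<close> tends to minus infinity and is positive for
  every \<open>x\<close>; both facts are needed for the crossing probabilities.
\<close>

lemma prob_exceeds_extreme_level_ge:
  assumes \<eta>: "\<eta> > 0"
  obtains \<kappa> K where "\<kappa> > 0" "K > 0"
    "\<And>x. eventually (\<lambda>R. \<kappa> * exp (- x) / ((1 + \<eta>) * (\<kappa> * exp (- x)) + K) \<le> prob (exceeds R (extreme_level R x))) at_top"
proof -
  obtain c \<epsilon> W where c: "c > 0" "\<epsilon> > 0" "W \<ge> 1"
    and pair: "\<And>w u j k. w \<ge> W \<Longrightarrow> w / 2 \<le> u \<Longrightarrow> u \<le> 2 * w \<Longrightarrow>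
       prob {\<omega> \<in> space M. X \<omega> (real j / w) > u \<and> X \<omega> (real k / w) > u} \<le>
         (1 + \<eta>) * (normal_tail u)\<^sup>2 +
         2 * normal_tail u * (exp (- c) ^ nat \<bar>int k - int j\<bar>
            + exp (- c * w\<^sup>2) * indicator {..exp (\<epsilon> * w\<^sup>2) * w} \<bar>real k - real j\<bar>)"
    and lim: "((\<lambda>w. exp (- c * w\<^sup>2) * (2 * (exp (\<epsilon> * w\<^sup>2) * w) + 1)) \<longlongrightarrow> 0) at_top"
    by (rule prob_pair_exceeds_le[OF \<eta>]) (rule that)
  \<comment> \<open>The factor \<open>exp (- 1)\<close> absorbs the square of \<open>x / w\<close>; eight is \<open>2 \<cdot> 2 \<cdot> 2\<close>, from halving the
    number of grid points, from Mills' ratio and from \<open>u \<le> 2 w\<close>.\<close>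
  define \<kappa> :: real where "\<kappa> = exp (- 1) / (8 * sqrt (2 * pi))"
  define K where "K = 2 * (2 / (1 - exp (- c)) + 1)"
  have \<kappa>: "\<kappa> > 0" by (simp add: \<kappa>_def)
  have K: "K > 0" using c by (simp add: K_def add_pos_pos)
  have "eventually (\<lambda>R. \<kappa> * exp (- x) / ((1 + \<eta>) * (\<kappa> * exp (- x)) + K) \<le> prob (exceeds R (extreme_level R x))) at_top" for x
  proof -
    have small: "eventually (\<lambda>w. exp (- c * w\<^sup>2) * (2 * (exp (\<epsilon> * w\<^sup>2) * w) + 1) < 1) at_top"
      using order_tendstoD(2)[OF lim zero_less_one] .
    have large: "eventually (\<lambda>w. w \<ge> max (max W 2) (2 * \<bar>x\<bar> + 2)) at_top" by (rule eventually_ge_at_top)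
    have "filterlim (\<lambda>R::real. sqrt (2 * ln R)) at_top at_top" by real_asymp
    from eventually_compose_filterlim[OF eventually_conj[OF small large] this]
    have "eventually (\<lambda>R. exp (- c * (sqrt (2 * ln R))\<^sup>2) * (2 * (exp (\<epsilon> * (sqrt (2 * ln R))\<^sup>2) * sqrt (2 * ln R)) + 1) < 1 \<and>
        max (max W 2) (2 * \<bar>x\<bar> + 2) \<le> sqrt (2 * ln R)) at_top" .
    moreover have "eventually (\<lambda>R::real. R > 1) at_top" by (rule eventually_gt_at_top)
    ultimately show ?thesis
    proof eventually_elim
      case (elim R)
      define w where "w = sqrt (2 * ln R)"
      define u where "u = extreme_level R x"
      have small: "exp (- c * w\<^sup>2) * (2 * (exp (\<epsilon> * w\<^sup>2) * w) + 1) < 1"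
        and w: "w \<ge> W" "w \<ge> 2" "w \<ge> 2 * \<bar>x\<bar> + 2" and R: "R > 1"
        using elim unfolding w_def[symmetric] by auto
      have lnR: "ln R = w\<^sup>2 / 2" using R by (simp add: w_def)
      have Rw: "R = exp (w\<^sup>2 / 2)" unfolding lnR[symmetric] using R by simp
      have u_def': "u = w + x / w" by (simp add: u_def extreme_level_def w_def)
      have xw: "\<bar>x / w\<bar> \<le> 1 / 2" using w by (simp add: field_simps)
      have u: "w / 2 \<le> u" "u \<le> 2 * w" "u \<ge> 1"
        using abs_le_D1[OF xw] abs_le_D2[OF xw] w(2) unfolding u_def' by linarith+
      define n where "n = nat \<lfloor>R * w\<rfloor>"
      have "R * w \<ge> 1 * 2" using R w by (intro mult_mono) auto
      then have n: "real n \<le> R * w" "real n \<ge> R * w / 2" unfolding n_def by linarith+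
      define p where "p = normal_tail u"
      have p: "p > 0" using u(3) by (simp add: p_def normal_tail_pos)
      define A where "A k = {\<omega> \<in> space M. X \<omega> (real k / w) > u}" for k :: nat
      have [measurable]: "A k \<in> events" for k unfolding A_def by measurable
      have pA: "prob (A k) = p" for k unfolding A_def p_def by (rule prob_exceed_at)
      have AA: "prob (A j \<inter> A k) \<le> (1 + \<eta>) * p\<^sup>2 + 2 * p * (exp (- c) ^ nat \<bar>int k - int j\<bar>
            + exp (- c * w\<^sup>2) * indicator {..exp (\<epsilon> * w\<^sup>2) * w} \<bar>real k - real j\<bar>)" for j k
      proof -
        have "A j \<inter> A k = {\<omega> \<in> space M. X \<omega> (real j / w) > u \<and> X \<omega> (real k / w) > u}"
          by (auto simp: A_def)
        then show ?thesis using pair[OF w(1) u(1,2), of j k] by (simp add: p_def)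
      qed
      define m where "m = real n * p"
      have row: "(\<Sum>k<n. prob (A j \<inter> A k)) \<le> real n * ((1 + \<eta>) * p\<^sup>2) + p * K" for j
      proof -
        have "(\<Sum>k<n. prob (A j \<inter> A k)) \<le> (\<Sum>k<n. (1 + \<eta>) * p\<^sup>2 + 2 * p * (exp (- c) ^ nat \<bar>int k - int j\<bar>
            + exp (- c * w\<^sup>2) * indicator {..exp (\<epsilon> * w\<^sup>2) * w} \<bar>real k - real j\<bar>))"
          by (intro sum_mono AA)
        also have "\<dots> = real n * ((1 + \<eta>) * p\<^sup>2) + 2 * p * ((\<Sum>k<n. exp (- c) ^ nat \<bar>int k - int j\<bar>)
            + exp (- c * w\<^sup>2) * (\<Sum>k<n. indicator {..exp (\<epsilon> * w\<^sup>2) * w} \<bar>real k - real j\<bar>))"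
          by (simp only: sum.distrib sum_distrib_left[symmetric]) simp
        also have "\<dots> \<le> real n * ((1 + \<eta>) * p\<^sup>2) + 2 * p * (2 / (1 - exp (- c)) + 1)"
        proof (intro add_left_mono mult_left_mono add_mono)
          show "(\<Sum>k<n. exp (- c) ^ nat \<bar>int k - int j\<bar>) \<le> 2 / (1 - exp (- c))"
            using c by (intro sum_geometric_distance_le) auto
          have "exp (- c * w\<^sup>2) * (\<Sum>k<n. indicator {..exp (\<epsilon> * w\<^sup>2) * w} \<bar>real k - real j\<bar>)
              \<le> exp (- c * w\<^sup>2) * (2 * (exp (\<epsilon> * w\<^sup>2) * w) + 1)"
            using w by (intro mult_left_mono sum_indicator_distance_le) auto
          then show "exp (- c * w\<^sup>2) * (\<Sum>k<n. indicator {..exp (\<epsilon> * w\<^sup>2) * w} \<bar>real k - real j\<bar>) \<le> 1"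
            using small by linarith
        qed (use p in auto)
        finally show ?thesis unfolding K_def by (simp only: mult_ac)
      qed
      have "real n > 0" using n(2) \<open>R * w \<ge> 1 * 2\<close> by linarith
      then have m_pos: "m > 0" using p by (simp add: m_def)
      have "(\<Sum>j<n. \<Sum>k<n. prob (A j \<inter> A k)) \<le> (\<Sum>j<n. real n * ((1 + \<eta>) * p\<^sup>2) + p * K)"
        by (intro sum_mono row)
      also have "\<dots> = (1 + \<eta>) * m\<^sup>2 + K * m" by (simp add: m_def power2_eq_square algebra_simps)
      finally have sum: "(\<Sum>j<n. \<Sum>k<n. prob (A j \<inter> A k)) \<le> (1 + \<eta>) * m\<^sup>2 + K * m" .
      have m_ge: "\<kappa> * exp (- x) \<le> m"
      proof -
        have "u\<^sup>2 / 2 = w\<^sup>2 / 2 + x + (x / w)\<^sup>2 / 2"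
          unfolding u_def' using w by (simp add: field_simps power2_eq_square)
        moreover have "(x / w)\<^sup>2 \<le> (1 / 2)\<^sup>2" using power_mono[OF xw abs_ge_zero, of 2] unfolding power2_abs by simp
        moreover have "(1 / 2 :: real)\<^sup>2 \<le> 1" by (simp add: power2_eq_square)
        ultimately have "u\<^sup>2 / 2 \<le> w\<^sup>2 / 2 + x + 1" by linarith
        then have "exp (- (w\<^sup>2 / 2 + x + 1)) \<le> exp (- u\<^sup>2 / 2)" by simp
        moreover have "exp (- (w\<^sup>2 / 2 + x + 1)) = exp (- 1) * exp (- x) / R"
          unfolding Rw by (simp add: exp_add[symmetric] exp_diff[symmetric] algebra_simps)
        ultimately have e: "exp (- 1) * exp (- x) / R \<le> exp (- u\<^sup>2 / 2)" by (simp only:)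
        have "\<kappa> * exp (- x) = (R * w / 2) * ((exp (- 1) * exp (- x) / R) / sqrt (2 * pi) / (2 * (2 * w)))"
          using R w by (simp add: \<kappa>_def)
        also have "\<dots> \<le> (R * w / 2) * (exp (- u\<^sup>2 / 2) / sqrt (2 * pi) / (2 * u))"
          using e R w u by (intro mult_left_mono frac_le divide_right_mono) auto
        also have "\<dots> \<le> (R * w / 2) * p"
          using normal_tail_ge[OF u(3)] R w unfolding p_def std_normal_density_def by (intro mult_left_mono) auto
        also have "\<dots> \<le> m" using n p unfolding m_def by (intro mult_right_mono) auto
        finally show ?thesis .
      qed
      have "(m)\<^sup>2 / ((1 + \<eta>) * m\<^sup>2 + K * m) \<le> prob (\<Union>k<n. A k)"
        using second_moment_lower_bound[of A p n] sum pA m_pos unfolding m_def by auto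
      also have "\<dots> \<le> prob (exceeds R u)"
      proof (rule finite_measure_mono_AE)
        show "AE \<omega> in M. \<omega> \<in> (\<Union>k<n. A k) \<longrightarrow> \<omega> \<in> exceeds R u"
          using smooth
        proof eventually_elim
          case (elim \<omega>)
          show ?case
          proof
            assume "\<omega> \<in> (\<Union>k<n. A k)"
            then obtain k where k: "k < n" "\<omega> \<in> space M" "X \<omega> (real k / w) > u" by (auto simp: A_def)
            have "real k \<le> R * w" using k(1) n(1) by linarith
            then have "real k / w \<in> {0..R}" using w by (simp add: field_simps)
            then show "\<omega> \<in> exceeds R u"
              using exceeds_iff[OF C2_smooth_imp_continuous[OF elim] k(2), of R u] R k(3) by auto
          qed
        qed
      qed simp
      finally have "m\<^sup>2 / ((1 + \<eta>) * m\<^sup>2 + K * m) \<le> prob (exceeds R u)" .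
      moreover have "m\<^sup>2 / ((1 + \<eta>) * m\<^sup>2 + K * m) = m / ((1 + \<eta>) * m + K)"
      proof -
        have "m\<^sup>2 / ((1 + \<eta>) * m\<^sup>2 + K * m) = (m * m) / (m * ((1 + \<eta>) * m + K))"
          by (simp add: power2_eq_square algebra_simps)
        then show ?thesis using m_pos by simp
      qed
      moreover have "\<kappa> * exp (- x) / ((1 + \<eta>) * (\<kappa> * exp (- x)) + K) \<le> m / ((1 + \<eta>) * m + K)"
      proof -
        define z where "z = \<kappa> * exp (- x)"
        have z: "z > 0" "z \<le> m" using \<kappa> m_ge by (simp_all add: z_def)
        have "K * z \<le> K * m" using z K by simp
        then show ?thesis unfolding z_def[symmetric] using z m_pos \<eta> K
          by (simp add: divide_le_eq le_divide_eq add_pos_pos field_simps)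
      qed
      ultimately show ?case by (simp add: u_def)
    qed
  qed
  with \<kappa> K that show thesis by blast
qed

end

section \<open>Crossings for additive functions\<close>

text \<open>
  A crossing path visits every abscissa, in particular one where \<open>u\<close> is maximal, at some height \<open>y\<close>.
  There the sum is at most \<open>l\<close>, hence it is so along the whole horizontal line of height \<open>y\<close>.
\<close>

lemma left_right_crossing_additive_iff:
  fixes u v :: "real \<Rightarrow> real"
  assumes u: "continuous_on UNIV u" and R: "R > 0"
  shows "left_right_crossing (\<lambda>(x, y). u x + v y) l R R \<longleftrightarrow> (\<exists>y\<in>{0..R}. \<forall>x\<in>{0..R}. u x + v y \<le> l)"
proof
  assume "left_right_crossing (\<lambda>(x, y). u x + v y) l R R"
  then obtain \<gamma> :: "real \<Rightarrow> real \<times> real" where \<gamma>: "path \<gamma>"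
      "path_image \<gamma> \<subseteq> {x. (\<lambda>(x, y). u x + v y) x \<le> l} \<inter> ({0..R} \<times> {0..R})"
      "path_image \<gamma> \<inter> ({0} \<times> {0..R}) \<noteq> {}" "path_image \<gamma> \<inter> ({R} \<times> {0..R}) \<noteq> {}"
    unfolding left_right_crossing_def by (elim exE conjE) (rule that)
  have "connected (fst ` path_image \<gamma>)"
    using connected_path_image[OF \<gamma>(1)] by (intro connected_continuous_image continuous_on_fst continuous_on_id)
  moreover have "0 \<in> fst ` path_image \<gamma>" "R \<in> fst ` path_image \<gamma>" using \<gamma>(3,4) by force+
  ultimately have sub: "{0..R} \<subseteq> fst ` path_image \<gamma>" by (rule connected_contains_Icc)
  obtain x0 where x0: "x0 \<in> {0..R}" "\<And>x. x \<in> {0..R} \<Longrightarrow> u x \<le> u x0"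
    using continuous_attains_sup[of "{0..R}" u] R continuous_on_subset[OF u] by auto
  obtain y where y: "(x0, y) \<in> path_image \<gamma>" using sub x0(1) by force
  then have "u x0 + v y \<le> l" "y \<in> {0..R}" using \<gamma>(2) by auto
  then show "\<exists>y\<in>{0..R}. \<forall>x\<in>{0..R}. u x + v y \<le> l" using x0(2) by force
next
  assume "\<exists>y\<in>{0..R}. \<forall>x\<in>{0..R}. u x + v y \<le> l"
  then obtain y where y: "y \<in> {0..R}" "\<And>x. x \<in> {0..R} \<Longrightarrow> u x + v y \<le> l" by blast
  define \<gamma> where "\<gamma> = (\<lambda>t. (t * R, y))"
  have "path \<gamma>" unfolding path_def \<gamma>_def by (intro continuous_intros)
  moreover have "path_image \<gamma> \<subseteq> {x. (\<lambda>(x, y). u x + v y) x \<le> l} \<inter> ({0..R} \<times> {0..R})"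
  proof -
    have "t * R \<in> {0..R}" if "t \<in> {0..1}" for t using that R by (auto simp: mult_left_le_one_le)
    then show ?thesis using y by (auto simp: path_image_def \<gamma>_def)
  qed
  moreover have "\<gamma> 0 \<in> path_image \<gamma> \<inter> ({0} \<times> {0..R})"
    using y(1) by (auto simp: path_image_def \<gamma>_def)
  then have "path_image \<gamma> \<inter> ({0} \<times> {0..R}) \<noteq> {}" by (metis empty_iff)
  moreover have "\<gamma> 1 \<in> path_image \<gamma> \<inter> ({R} \<times> {0..R})"
    using y(1) by (auto simp: path_image_def \<gamma>_def)
  then have "path_image \<gamma> \<inter> ({R} \<times> {0..R}) \<noteq> {}" by (metis empty_iff)
  ultimately show "left_right_crossing (\<lambda>(x, y). u x + v y) l R R"
    unfolding left_right_crossing_def by (intro exI[of _ \<gamma>] conjI)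
qed

text \<open>
  A countable description of the crossing event. The slack \<open>1 / Suc n\<close> makes up for the minimum of
  \<open>v\<close> being attained at an irrational height.
\<close>

lemma horizontal_line_iff_rational:
  fixes u v :: "real \<Rightarrow> real"
  assumes u: "continuous_on UNIV u" and v: "continuous_on UNIV v" and R: "R > 0"
  shows "(\<exists>y\<in>{0..R}. \<forall>x\<in>{0..R}. u x + v y \<le> l) \<longleftrightarrow>
     (\<forall>n::nat. \<exists>q\<in>{0..R} \<inter> \<rat>. \<forall>p\<in>{0..R} \<inter> \<rat>. u p + v q < l + 1 / real (Suc n))"
proof safe
  fix y and n :: nat assume y: "y \<in> {0..R}" "\<forall>x\<in>{0..R}. u x + v y \<le> l"
  have "continuous_on UNIV (\<lambda>t. - v t)" using v by (intro continuous_intros)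
  moreover have "- v y > - v y - 1 / real (Suc n)" by simp
  ultimately obtain q where "q \<in> \<rat>" "q \<in> {0..R}" "- v q > - v y - 1 / real (Suc n)"
    using exceeds_at_rational[OF _ R y(1)] by metis
  then show "\<exists>q\<in>{0..R} \<inter> \<rat>. \<forall>p\<in>{0..R} \<inter> \<rat>. u p + v q < l + 1 / real (Suc n)"
    using y(2) by (intro bexI[of _ q]) force+
next
  assume *: "\<forall>n::nat. \<exists>q\<in>{0..R} \<inter> \<rat>. \<forall>p\<in>{0..R} \<inter> \<rat>. u p + v q < l + 1 / real (Suc n)"
  obtain y where y: "y \<in> {0..R}" "\<And>t. t \<in> {0..R} \<Longrightarrow> v y \<le> v t"
    using continuous_attains_inf[of "{0..R}" v] R continuous_on_subset[OF v] by auto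
  have "u x + v y \<le> l" if x: "x \<in> {0..R}" for x
  proof (rule ccontr)
    assume "\<not> u x + v y \<le> l"
    then have pos: "u x + v y - l > 0" by simp
    then obtain n :: nat where n: "1 / real (Suc n) < u x + v y - l"
      using nat_approx_posE by blast
    then have "u x > l - v y + 1 / real (Suc n)" by linarith
    from exceeds_at_rational[OF u R x this] obtain p
      where p: "p \<in> \<rat>" "p \<in> {0..R}" "u p > l - v y + 1 / real (Suc n)" .
    from * obtain q where q: "q \<in> {0..R}" "\<forall>p\<in>{0..R} \<inter> \<rat>. u p + v q < l + 1 / real (Suc n)" by blast
    have "u p + v q < l + 1 / real (Suc n)" using p(1,2) q(2) by blast
    moreover have "v y \<le> v q" using y(2) q(1) by simp
    ultimately show False using p(3) by linarith
  qed
  with y(1) show "\<exists>y\<in>{0..R}. \<forall>x\<in>{0..R}. u x + v y \<le> l" by blast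
qed

text \<open>
  For continuous paths the crossing event has a countable description, so it is measurable up to a
  subset of the null set of bad paths.
\<close>

lemma Cross_additive_completion_measurable:
  assumes meas: "\<And>t. (\<lambda>\<omega>. g1 \<omega> t) \<in> borel_measurable M" "\<And>t. (\<lambda>\<omega>. g2 \<omega> t) \<in> borel_measurable M"
    and cont: "AE \<omega> in M. continuous_on UNIV (g1 \<omega>)" "AE \<omega> in M. continuous_on UNIV (g2 \<omega>)"
    and R: "R > 0"
  shows "Cross M (\<lambda>\<omega> (x1, x2). g1 \<omega> x1 + g2 \<omega> x2) l R R \<in> sets (completion M)" (is "?C \<in> _")
proof -
  note [measurable] = meas
  define E where "E = {\<omega> \<in> space M. \<forall>n::nat. \<exists>q\<in>{0..R} \<inter> \<rat>. \<forall>p\<in>{0..R} \<inter> \<rat>. g1 \<omega> p + g2 \<omega> q < l + 1 / real (Suc n)}"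
  have "countable ({0..R} \<inter> \<rat>)" by (simp add: countable_rat)
  then have [measurable]: "E \<in> sets M" unfolding E_def by measurable
  have "AE \<omega> in M. \<omega> \<in> ?C \<longleftrightarrow> \<omega> \<in> E"
    using cont
  proof eventually_elim
    case (elim \<omega>)
    show ?case
      unfolding Cross_def E_def
      using left_right_crossing_additive_iff[OF elim(1) R, of "g2 \<omega>" l] horizontal_line_iff_rational[OF elim R, of l]
      by simp
  qed
  then obtain N where N: "N \<in> null_sets M" "{\<omega> \<in> space M. \<not> (\<omega> \<in> ?C \<longleftrightarrow> \<omega> \<in> E)} \<subseteq> N"
    unfolding eventually_ae_filter by blast
  have "?C \<subseteq> space M" by (auto simp: Cross_def)
  moreover have "E \<subseteq> space M" by (auto simp: E_def)
  ultimately have "?C = (E - N) \<union> (?C \<inter> N)" using N(2) by blast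
  then show ?thesis
    by (rule sets_completionI[where N' = N]) (use N(1) in auto)
qed

section \<open>Normalising the process\<close>

lemma (in prob_space) gaussian_rv_centred_normal:
  assumes Z: "gaussian_rv M Z" and mean: "expectation Z = 0"
  shows "integrable M (\<lambda>\<omega>. (Z \<omega>)\<^sup>2)" and "centred_normal M Z (expectation (\<lambda>\<omega>. (Z \<omega>)\<^sup>2))"
proof -
  have [measurable]: "Z \<in> borel_measurable M" using Z by (simp add: gaussian_rv_def)
  have "\<exists>v. centred_normal M Z v"
    using Z unfolding gaussian_rv_def
  proof (elim conjE disjE exE)
    fix \<mu> \<sigma> :: real assume D: "0 < \<sigma>" "distributed M lborel Z (normal_density \<mu> \<sigma>)"
    then have "\<mu> = 0" using normal_distributed_expectation[OF D] mean by simp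
    then have "centred_normal M Z (\<sigma>\<^sup>2)" using D by (simp add: centred_normal_def)
    then show ?thesis ..
  next
    fix \<mu> assume ae: "AE \<omega> in M. Z \<omega> = \<mu>"
    then have "expectation Z = expectation (\<lambda>_. \<mu>)" by (intro integral_cong_AE) auto
    then have "\<mu> = 0" using mean by (simp add: prob_space)
    then have "centred_normal M Z 0" using ae by (simp add: centred_normal_def)
    then show ?thesis ..
  qed
  then obtain v where v: "centred_normal M Z v" ..
  from centred_normal_second_moment[OF v] v
  show "integrable M (\<lambda>\<omega>. (Z \<omega>)\<^sup>2)" and "centred_normal M Z (expectation (\<lambda>\<omega>. (Z \<omega>)\<^sup>2))" by simp_all
qed

text \<open>
  The factor \<open>c\<close> may have either sign: the second process is used with its sign reversed. The
  variance is positive because a continuous process that vanishes almost surely at each rational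
  time is identically zero.
\<close>

lemma smooth_stationary_gaussian_normalised:
  fixes M :: "'a measure" and g :: "'a \<Rightarrow> real \<Rightarrow> real" and K :: "real \<Rightarrow> real"
  assumes "prob_space M" and gauss: "gaussian_process M g" and cent: "centred_process M g"
    and stat: "stationary_process M g" and K: "K = covariance_kernel M g"
    and nonzero: "\<not> (AE \<omega> in M. \<forall>t. g \<omega> t = 0)"
    and smooth: "AE \<omega> in M. C2_smooth (g \<omega>)"
    and decay: "((\<lambda>t. K t * ln \<bar>t\<bar>) \<longlongrightarrow> 0) at_infinity"
  shows "K 0 > 0"
    and "c\<^sup>2 = 1 / K 0 \<Longrightarrow> smooth_stationary_gaussian M (\<lambda>\<omega> t. c * g \<omega> t) (\<lambda>t. K t / K 0)"
proof -
  interpret prob_space M by fact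
  have path: "g \<in> M \<rightarrow>\<^sub>M path_space" using stat by (simp add: stationary_process_def)
  have meas[measurable]: "(\<lambda>\<omega>. g \<omega> t) \<in> borel_measurable M" for t
    using measurable_compose[OF path measurable_component_singleton[of t UNIV "\<lambda>_. borel"]] by simp
  have int: "integrable M (\<lambda>\<omega>. g \<omega> t)" and mean: "expectation (\<lambda>\<omega>. g \<omega> t) = 0" for t
    using cent by (simp_all add: centred_process_def)
  have combination: "gaussian_rv M (\<lambda>\<omega>. \<Sum>r\<in>T. d r * g \<omega> r)" if "finite T" for T d
    using gauss that by (simp add: gaussian_process_def)
  have gauss2: "gaussian_rv M (\<lambda>\<omega>. a * g \<omega> s + b * g \<omega> t)" for a b s t
  proof (cases "s = t")
    case True
    then show ?thesis using combination[of "{t}" "\<lambda>_. a + b"] by (simp add: algebra_simps)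
  next
    case False
    then show ?thesis using combination[of "{s, t}" "\<lambda>r. if r = s then a else b"] by simp
  qed
  have mean2: "expectation (\<lambda>\<omega>. a * g \<omega> s + b * g \<omega> t) = 0" for a b s t
    using int mean by simp
  note square = gaussian_rv_centred_normal[OF gauss2 mean2]
  have int2: "integrable M (\<lambda>\<omega>. (g \<omega> t)\<^sup>2)" for t using square(1)[of 1 t 0 t] by simp
  have prod: "integrable M (\<lambda>\<omega>. g \<omega> s * g \<omega> t)" for s t
  proof -
    have "integrable M (\<lambda>\<omega>. ((1 * g \<omega> s + 1 * g \<omega> t)\<^sup>2 - (g \<omega> s)\<^sup>2 - (g \<omega> t)\<^sup>2) / 2)"
      using int2 square(1) by (intro Bochner_Integration.integrable_divide Bochner_Integration.integrable_diff)
    then show ?thesis by (simp add: power2_eq_square algebra_simps)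
  qed
  have cov: "expectation (\<lambda>\<omega>. g \<omega> s * g \<omega> t) = K (t - s)" for s t
  proof -
    have comp: "(\<lambda>x :: real \<Rightarrow> real. x r) \<in> path_space \<rightarrow>\<^sub>M borel" for r
      by (rule measurable_component_singleton) simp
    have m: "(\<lambda>x :: real \<Rightarrow> real. x 0 * x (t - s)) \<in> borel_measurable path_space"
      by (intro borel_measurable_times comp)
    have shift: "(\<lambda>\<omega> r. g \<omega> (r + s)) \<in> M \<rightarrow>\<^sub>M path_space"
      by (rule measurable_PiM_single') (auto simp: space_PiM)
    have "expectation (\<lambda>\<omega>. g \<omega> s * g \<omega> t) = (\<integral>x. x 0 * x (t - s) \<partial>distr M path_space (\<lambda>\<omega> r. g \<omega> (r + s)))"
      by (subst integral_distr[OF shift m]) simp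
    also have "\<dots> = (\<integral>x. x 0 * x (t - s) \<partial>distr M path_space g)"
      using stat by (simp add: stationary_process_def)
    also have "\<dots> = K (t - s)"
      by (subst integral_distr[OF path m]) (simp add: K covariance_kernel_def)
    finally show ?thesis .
  qed
  have normal: "centred_normal M (\<lambda>\<omega>. a * g \<omega> s + b * g \<omega> t) (K 0 * (a\<^sup>2 + b\<^sup>2) + 2 * a * b * K (t - s))" for a b s t
  proof -
    have "expectation (\<lambda>\<omega>. (a * g \<omega> s + b * g \<omega> t)\<^sup>2) =
      expectation (\<lambda>\<omega>. a\<^sup>2 * (g \<omega> s * g \<omega> s) + b\<^sup>2 * (g \<omega> t * g \<omega> t) + (2 * a * b) * (g \<omega> s * g \<omega> t))"
      by (intro Bochner_Integration.integral_cong) (auto simp: power2_eq_square algebra_simps)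
    also have "\<dots> = a\<^sup>2 * K 0 + b\<^sup>2 * K 0 + 2 * a * b * K (t - s)"
      using prod by (simp add: cov)
    finally show ?thesis using square(2)[of a s b t] by (simp add: algebra_simps)
  qed
  have K0_nonneg: "K 0 \<ge> 0"
    using centred_normal_variance_nonneg[OF normal[of 1 0 0 0]] by simp
  show pos: "K 0 > 0"
  proof (rule ccontr)
    assume "\<not> K 0 > 0"
    then have "K 0 = 0" using K0_nonneg by simp
    then have "AE \<omega> in M. g \<omega> t = 0" for t using normal[of 1 t 0 t] by (simp add: centred_normal_def)
    then have "AE \<omega> in M. \<forall>q\<in>\<rat>. g \<omega> q = 0" by (subst AE_ball_countable) (auto simp: countable_rat)
    with smooth have "AE \<omega> in M. \<forall>t. g \<omega> t = 0"
    proof eventually_elim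
      case (elim \<omega>)
      note cont = C2_smooth_imp_continuous[OF elim(1)]
      have "closure \<rat> = (UNIV :: real set)" by (rule Rats_closure_real)
      then have "g \<omega> t = 0" for t
        using continuous_constant_on_closure[of \<rat> "g \<omega>" 0 t] cont elim(2) by auto
      then show ?case ..
    qed
    with nonzero show False by simp
  qed
  assume c: "c\<^sup>2 = 1 / K 0"
  show "smooth_stationary_gaussian M (\<lambda>\<omega> t. c * g \<omega> t) (\<lambda>t. K t / K 0)"
  proof
    fix a b s t
    have "a\<^sup>2 + b\<^sup>2 + 2 * a * b * (K (t - s) / K 0) = K 0 * ((a * c)\<^sup>2 + (b * c)\<^sup>2) + 2 * (a * c) * (b * c) * K (t - s)"
    proof -
      have "K 0 * ((a * c)\<^sup>2 + (b * c)\<^sup>2) + 2 * (a * c) * (b * c) * K (t - s) =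
        c\<^sup>2 * (K 0 * (a\<^sup>2 + b\<^sup>2) + 2 * a * b * K (t - s))"
        by (simp add: power2_eq_square algebra_simps)
      then show ?thesis unfolding c using pos by (simp add: field_simps)
    qed
    then show "centred_normal M (\<lambda>\<omega>. a * (c * g \<omega> s) + b * (c * g \<omega> t)) (a\<^sup>2 + b\<^sup>2 + 2 * a * b * (K (t - s) / K 0))"
      using normal[of "a * c" s "b * c" t] by (simp add: mult.assoc)
  next
    show "AE \<omega> in M. C2_smooth (\<lambda>t. c * g \<omega> t)"
      using smooth
    proof eventually_elim
      case (elim \<omega>)
      then obtain u' u'' where u: "\<forall>t. (g \<omega> has_real_derivative u' t) (at t)"
        "\<forall>t. (u' has_real_derivative u'' t) (at t)" "continuous_on UNIV u''"
        unfolding C2_smooth_def by blast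
      show ?case unfolding C2_smooth_def
        by (intro exI[of _ "\<lambda>t. c * u' t"] exI[of _ "\<lambda>t. c * u'' t"])
           (use u in \<open>auto intro!: DERIV_cmult continuous_intros\<close>)
    qed
  next
    show "((\<lambda>t. K t / K 0 * ln \<bar>t\<bar>) \<longlongrightarrow> 0) at_infinity"
      using tendsto_divide[OF decay tendsto_const, of "K 0"] pos by simp
  qed
qed

section \<open>Crossing probabilities\<close>

theorem theorem1p9:
  fixes M :: "'a measure"
    and g1 g2 :: "'a \<Rightarrow> real \<Rightarrow> real"
    and K1 K2 :: "real \<Rightarrow> real"
    and f :: "'a \<Rightarrow> real \<times> real \<Rightarrow> real"
    and ell :: "real \<Rightarrow> real"
  assumes "prob_space M"
    and "prob_space.indep_var M path_space g1 path_space g2"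
    and "gaussian_process M g1" and "gaussian_process M g2"
    and "centred_process M g1" and "centred_process M g2"
    and "stationary_process M g1" and "stationary_process M g2"
    and "K1 = covariance_kernel M g1" and "K2 = covariance_kernel M g2"
    and "\<not> (AE \<omega> in M. \<forall>t. g1 \<omega> t = 0)" and "\<not> (AE \<omega> in M. \<forall>t. g2 \<omega> t = 0)"
    and "AE \<omega> in M. C2_smooth (g1 \<omega>)" and "AE \<omega> in M. C2_smooth (g2 \<omega>)"
    and "((\<lambda>t. K1 t * ln \<bar>t\<bar>) \<longlongrightarrow> 0) at_infinity"
    and "((\<lambda>t. K2 t * ln \<bar>t\<bar>) \<longlongrightarrow> 0) at_infinity"
    and "f = (\<lambda>\<omega> (x1, x2). g1 \<omega> x1 + g2 \<omega> x2)"
    and "K1 0 = K2 0"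
    and "\<And>R. R > 0 \<Longrightarrow> ell R \<ge> 0"
  shows "(filterlim (\<lambda>R. ell R * sqrt (ln R)) at_top at_top \<longrightarrow>
            ((\<lambda>R. cross_prob M f (ell R) R R) \<longlongrightarrow> 1) at_top) \<and>
         (Limsup at_top (\<lambda>R. ereal (ell R * sqrt (ln R))) < \<infinity> \<longrightarrow>
            Limsup at_top (\<lambda>R. ereal (cross_prob M f (ell R) R R)) < 1)"
proof -
  interpret prob_space M by fact
  interpret completion: prob_space "completion M" by (rule prob_space_completion)
  define \<sigma> where "\<sigma> = sqrt (K1 0)"
  have "K1 0 > 0"
    by (rule smooth_stationary_gaussian_normalised(1)[OF assms(1,3,5,7,9,11,13,15)])
  then have \<sigma>: "\<sigma> > 0" "(1 / \<sigma>)\<^sup>2 = 1 / K1 0" "(- 1 / \<sigma>)\<^sup>2 = 1 / K2 0"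
    using assms(18) by (simp_all add: \<sigma>_def power_divide)
  define Y1 where "Y1 = (\<lambda>\<omega> t. 1 / \<sigma> * g1 \<omega> t)"
  define Y2 where "Y2 = (\<lambda>\<omega> t. - 1 / \<sigma> * g2 \<omega> t)"
  interpret X1: smooth_stationary_gaussian M Y1 "\<lambda>t. K1 t / K1 0"
    unfolding Y1_def by (rule smooth_stationary_gaussian_normalised(2)[OF assms(1,3,5,7,9,11,13,15) \<sigma>(2)])
  interpret X2: smooth_stationary_gaussian M Y2 "\<lambda>t. K2 t / K2 0"
    unfolding Y2_def by (rule smooth_stationary_gaussian_normalised(2)[OF assms(1,4,6,8,10,12,14,16) \<sigma>(3)])
  have path: "g1 \<in> M \<rightarrow>\<^sub>M path_space" "g2 \<in> M \<rightarrow>\<^sub>M path_space"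
    using assms(7,8) by (simp_all add: stationary_process_def)
  have coord: "(\<lambda>x :: real \<Rightarrow> real. x t) \<in> path_space \<rightarrow>\<^sub>M borel" for t
    by (rule measurable_component_singleton) simp
  have meas: "(\<lambda>\<omega>. g1 \<omega> t) \<in> borel_measurable M" "(\<lambda>\<omega>. g2 \<omega> t) \<in> borel_measurable M" for t
    using measurable_compose[OF path(1) coord] measurable_compose[OF path(2) coord] by simp_all
  have "AE \<omega> in M. continuous_on UNIV (g \<omega>)" if "AE \<omega> in M. C2_smooth (g \<omega>)" for g :: "'a \<Rightarrow> real \<Rightarrow> real"
    using that by eventually_elim (rule C2_smooth_imp_continuous)
  note cont = this[OF assms(13)] this[OF assms(14)]
  have Cross_iff: "\<omega> \<in> Cross M f l R R \<longleftrightarrow> (\<exists>y\<in>{0..R}. \<forall>x\<in>{0..R}. g1 \<omega> x + g2 \<omega> y \<le> l)"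
    if "continuous_on UNIV (g1 \<omega>)" "\<omega> \<in> space M" "R > 0" for \<omega> l R
    using left_right_crossing_additive_iff[OF that(1,3)] that(2) by (simp add: Cross_def assms(17))
  have exceeds1: "\<omega> \<in> X1.exceeds R u \<longleftrightarrow> (\<exists>t\<in>{0..R}. g1 \<omega> t > \<sigma> * u)"
    if "continuous_on UNIV (g1 \<omega>)" "\<omega> \<in> space M" "R > 0" for \<omega> R u
  proof -
    have "continuous_on UNIV (Y1 \<omega>)" unfolding Y1_def using that(1) by (intro continuous_intros)
    moreover have "Y1 \<omega> t > u \<longleftrightarrow> g1 \<omega> t > \<sigma> * u" for t
      using pos_less_divide_eq[OF \<sigma>(1), of u "g1 \<omega> t"] by (simp add: Y1_def mult.commute)
    ultimately show ?thesis using X1.exceeds_iff[OF _ that(2,3)] by simp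
  qed
  have exceeds2: "\<omega> \<in> X2.exceeds R u \<longleftrightarrow> (\<exists>t\<in>{0..R}. - g2 \<omega> t > \<sigma> * u)"
    if "continuous_on UNIV (g2 \<omega>)" "\<omega> \<in> space M" "R > 0" for \<omega> R u
  proof -
    have "continuous_on UNIV (Y2 \<omega>)" unfolding Y2_def using that(1) by (intro continuous_intros)
    moreover have "Y2 \<omega> t > u \<longleftrightarrow> - g2 \<omega> t > \<sigma> * u" for t
      using pos_less_divide_eq[OF \<sigma>(1), of u "- g2 \<omega> t"] by (simp add: Y2_def mult.commute)
    ultimately show ?thesis using X2.exceeds_iff[OF _ that(2,3)] by simp
  qed
  \<comment> \<open>If the maximum of the first process is at most \<open>\<sigma> u1\<close> and the minimum of the second one is below
    \<open>- \<sigma> u2\<close>, the line through that minimum crosses.\<close>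
  have cross_prob_ge: "prob (X2.exceeds R u2) - prob (X1.exceeds R u1) \<le> cross_prob M f l R R"
    if R: "R > 0" and u: "\<sigma> * (u1 - u2) \<le> l" for R u1 u2 l
  proof -
    have "prob (X2.exceeds R u2) \<le> prob ((X2.exceeds R u2 - X1.exceeds R u1) \<union> X1.exceeds R u1)"
      by (intro finite_measure_mono) auto
    also have "\<dots> \<le> prob (X2.exceeds R u2 - X1.exceeds R u1) + prob (X1.exceeds R u1)"
      by (rule measure_Un_le) auto
    also have "prob (X2.exceeds R u2 - X1.exceeds R u1) =
        measure (completion M) (X2.exceeds R u2 - X1.exceeds R u1)" by simp
    also have "\<dots> \<le> cross_prob M f l R R"
      unfolding cross_prob_def
    proof (rule completion.finite_measure_mono_AE)
      show "Cross M f l R R \<in> sets (completion M)"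
        unfolding assms(17) by (rule Cross_additive_completion_measurable[OF meas cont R])
      have "AE \<omega> in M. \<omega> \<in> X2.exceeds R u2 - X1.exceeds R u1 \<longrightarrow> \<omega> \<in> Cross M f l R R"
        using cont AE_space
      proof eventually_elim
        case (elim \<omega>)
        show ?case
        proof
          assume \<omega>: "\<omega> \<in> X2.exceeds R u2 - X1.exceeds R u1"
          then obtain y where y: "y \<in> {0..R}" "- g2 \<omega> y > \<sigma> * u2" using exceeds2[OF elim(2,3) R] by auto
          have "g1 \<omega> x + g2 \<omega> y \<le> l" if "x \<in> {0..R}" for x
          proof -
            have "g1 \<omega> x \<le> \<sigma> * u1" using \<omega> exceeds1[OF elim(1,3) R] that by (auto simp: not_less)
            then show ?thesis using y(2) u by (simp add: algebra_simps)
          qed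
          then show "\<omega> \<in> Cross M f l R R" using Cross_iff[OF elim(1,3) R] y(1) by blast
        qed
      qed
      then show "AE \<omega> in completion M. \<omega> \<in> X2.exceeds R u2 - X1.exceeds R u1 \<longrightarrow> \<omega> \<in> Cross M f l R R"
        by (rule AE_completion)
    qed
    finally show ?thesis by simp
  qed
  have indep: "prob (X1.exceeds R u1 - X2.exceeds R u2) = prob (X1.exceeds R u1) * (1 - prob (X2.exceeds R u2))" for R u1 u2
  proof -
    have countable: "countable ({0..R} \<inter> \<rat>)" by (simp add: countable_rat)
    define S1 where "S1 = {x \<in> space path_space. \<exists>t\<in>{0..R} \<inter> \<rat>. 1 / \<sigma> * x t > u1}"
    define S2 where "S2 = {x \<in> space path_space. \<not> (\<exists>t\<in>{0..R} \<inter> \<rat>. - 1 / \<sigma> * x t > u2)}"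
    note [measurable] = coord
    have Y: "Y1 \<omega> t = 1 / \<sigma> * g1 \<omega> t" "Y2 \<omega> t = - 1 / \<sigma> * g2 \<omega> t" for \<omega> t
      by (simp_all add: Y1_def Y2_def)
    have S: "S1 \<in> sets path_space" "S2 \<in> sets path_space"
      unfolding S1_def S2_def using countable by measurable
    have 1: "g1 -` S1 \<inter> space M = X1.exceeds R u1"
      by (auto simp: S1_def X1.exceeds_def Y space_PiM)
    have 2: "g2 -` S2 \<inter> space M = space M - X2.exceeds R u2"
      by (auto simp: S2_def X2.exceeds_def Y space_PiM)
    have "X1.exceeds R u1 - X2.exceeds R u2 = (\<lambda>\<omega>. (g1 \<omega>, g2 \<omega>)) -` (S1 \<times> S2) \<inter> space M"
      using 1 2 by (auto simp: X1.exceeds_def)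
    then show ?thesis
      using indep_varD[OF assms(2) S] 1 2 by (simp add: prob_compl)
  qed
  \<comment> \<open>In the opposite situation, whose probability factors by independence, there is no crossing.\<close>
  have cross_prob_le: "cross_prob M f l R R \<le> 1 - prob (X1.exceeds R u1) * (1 - prob (X2.exceeds R u2))"
    if R: "R > 0" and u: "l \<le> \<sigma> * (u1 - u2)" for R u1 u2 l
  proof -
    let ?B = "X1.exceeds R u1 - X2.exceeds R u2"
    have "cross_prob M f l R R \<le> measure (completion M) (space M - ?B)"
      unfolding cross_prob_def
    proof (rule completion.finite_measure_mono_AE)
      have "AE \<omega> in M. \<omega> \<in> Cross M f l R R \<longrightarrow> \<omega> \<in> space M - ?B"
        using cont AE_space
      proof eventually_elim
        case (elim \<omega>)
        have False if \<omega>: "\<omega> \<in> ?B" and C: "\<omega> \<in> Cross M f l R R"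
        proof -
          obtain y where y: "y \<in> {0..R}" "\<forall>x\<in>{0..R}. g1 \<omega> x + g2 \<omega> y \<le> l"
            using C Cross_iff[OF elim(1,3) R] by blast
          obtain x where x: "x \<in> {0..R}" "g1 \<omega> x > \<sigma> * u1" using \<omega> exceeds1[OF elim(1,3) R] by auto
          have "- g2 \<omega> y \<le> \<sigma> * u2" using \<omega> exceeds2[OF elim(2,3) R] y(1) by (auto simp: not_less)
          moreover have "g1 \<omega> x + g2 \<omega> y \<le> l" using y(2) x(1) by blast
          ultimately show False using x(2) u by (simp add: algebra_simps)
        qed
        then show ?case using elim(3) by blast
      qed
      then show "AE \<omega> in completion M. \<omega> \<in> Cross M f l R R \<longrightarrow> \<omega> \<in> space M - ?B"
        by (rule AE_completion)
    qed simp
    also have "\<dots> = 1 - prob ?B" by (simp add: prob_compl)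
    finally show ?thesis unfolding indep .
  qed
  \<comment> \<open>The two variances being equal, the leading terms of the two levels cancel and only the window of
    width \<open>1 / sqrt (ln R)\<close> remains.\<close>
  have level_diff: "\<sigma> * (extreme_level R x - extreme_level R y) = \<sigma> * (x - y) / (sqrt 2 * sqrt (ln R))" for R x y
    by (simp add: extreme_level_def real_sqrt_mult diff_divide_distrib[symmetric])
  obtain C1 where C1: "C1 > 0" "\<And>x. eventually (\<lambda>R. prob (X1.exceeds R (extreme_level R x)) \<le> C1 * exp (- x)) at_top"
    using X1.prob_exceeds_extreme_level_le by blast
  obtain C2 where C2: "C2 > 0" "\<And>x. eventually (\<lambda>R. prob (X2.exceeds R (extreme_level R x)) \<le> C2 * exp (- x)) at_top"
    using X2.prob_exceeds_extreme_level_le by blast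
  have tail_small: "\<exists>x. C * exp (- x) \<le> \<epsilon>" if "C > 0" "\<epsilon> > 0" for C \<epsilon> :: real
    using that by (intro exI[of _ "ln (C / \<epsilon>)"]) (simp add: exp_minus)
  have R_large: "eventually (\<lambda>R::real. R > 1) at_top" by (rule eventually_gt_at_top)
  show ?thesis
  proof (intro conjI impI)
    assume lim: "filterlim (\<lambda>R. ell R * sqrt (ln R)) at_top at_top"
    have lower: "eventually (\<lambda>R. 1 - \<epsilon> < cross_prob M f (ell R) R R) at_top" if \<epsilon>: "\<epsilon> > 0" for \<epsilon>
    proof -
      obtain x1 where x1: "C1 * exp (- x1) \<le> \<epsilon> / 2" using tail_small[OF C1(1), of "\<epsilon> / 2"] \<epsilon> by auto
      define \<eta> where "\<eta> = \<epsilon> / 2"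
      have \<eta>: "\<eta> > 0" using \<epsilon> by (simp add: \<eta>_def)
      obtain \<kappa> K where \<kappa>: "\<kappa> > 0" "K > 0"
        "\<And>x. eventually (\<lambda>R. \<kappa> * exp (- x) / ((1 + \<eta>) * (\<kappa> * exp (- x)) + K) \<le> prob (X2.exceeds R (extreme_level R x))) at_top"
        using X2.prob_exceeds_extreme_level_ge[OF \<eta>] by blast
      have "((\<lambda>z. z / ((1 + \<eta>) * z + K)) \<longlongrightarrow> inverse (1 + \<eta>)) at_top" using \<eta> by real_asymp
      moreover have "1 - \<eta> < inverse (1 + \<eta>)" using \<eta> by (simp add: field_simps)
      ultimately have "eventually (\<lambda>z. 1 - \<eta> < z / ((1 + \<eta>) * z + K)) at_top" by (rule order_tendstoD)
      then have "eventually (\<lambda>z. 1 - \<eta> < z / ((1 + \<eta>) * z + K) \<and> z > 0) at_top"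
        by (intro eventually_conj eventually_gt_at_top)
      then obtain z where z: "1 - \<eta> < z / ((1 + \<eta>) * z + K)" "z > 0"
        using eventually_happens'[OF trivial_limit_at_top_linorder] by blast
      define x2 where "x2 = - ln (z / \<kappa>)"
      have x2: "\<kappa> * exp (- x2) = z" using z \<kappa> by (simp add: x2_def)
      show ?thesis
        using C1(2)[of x1] \<kappa>(3)[of x2] lim[unfolded filterlim_at_top, rule_format, of "\<sigma> * \<bar>x1 - x2\<bar>"] R_large
      proof eventually_elim
        case (elim R)
        have "\<sigma> * (x1 - x2) / (sqrt 2 * sqrt (ln R)) \<le> \<sigma> * \<bar>x1 - x2\<bar> / (1 * sqrt (ln R))"
          using \<sigma>(1) elim by (intro frac_le mult_right_mono mult_left_mono) auto
        also have "\<dots> \<le> ell R" using elim by (simp add: divide_le_eq)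
        finally have "prob (X2.exceeds R (extreme_level R x2)) - prob (X1.exceeds R (extreme_level R x1))
            \<le> cross_prob M f (ell R) R R"
          using elim by (intro cross_prob_ge) (simp_all add: level_diff)
        then show ?case using elim(1,2) x1 z(1) unfolding x2 \<eta>_def by linarith
      qed
    qed
    have upper: "cross_prob M f (ell R) R R \<le> 1" for R unfolding cross_prob_def by simp
    show "((\<lambda>R. cross_prob M f (ell R) R R) \<longlongrightarrow> 1) at_top"
    proof (rule order_tendstoI)
      fix a :: real assume "a < 1"
      then show "eventually (\<lambda>R. a < cross_prob M f (ell R) R R) at_top" using lower[of "1 - a"] by simp
    next
      fix a :: real assume "1 < a"
      then show "eventually (\<lambda>R. cross_prob M f (ell R) R R < a) at_top"
        using upper by (intro always_eventually allI) (rule le_less_trans)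
    qed
  next
    assume "Limsup at_top (\<lambda>R. ereal (ell R * sqrt (ln R))) < \<infinity>"
    then obtain B :: nat where "Limsup at_top (\<lambda>R. ereal (ell R * sqrt (ln R))) < ereal (real B)"
      using less_PInf_Ex_of_nat by (metis less_irrefl)
    then have B: "eventually (\<lambda>R. ell R * sqrt (ln R) < real B) at_top"
      using Limsup_lessD by fastforce
    obtain x2 where x2: "C2 * exp (- x2) \<le> 1 / 2" using tail_small[OF C2(1), of "1 / 2"] by auto
    \<comment> \<open>The levels \<open>x1\<close> and \<open>x2\<close> are so far apart that the gap between them exceeds \<open>ell R\<close>.\<close>
    define x1 where "x1 = x2 + sqrt 2 * real B / \<sigma>"
    obtain \<kappa> K where \<kappa>: "\<kappa> > 0" "K > 0"
      "\<And>x. eventually (\<lambda>R. \<kappa> * exp (- x) / ((1 + 1) * (\<kappa> * exp (- x)) + K) \<le> prob (X1.exceeds R (extreme_level R x))) at_top"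
      using X1.prob_exceeds_extreme_level_ge[OF zero_less_one] by blast
    define p where "p = \<kappa> * exp (- x1) / ((1 + 1) * (\<kappa> * exp (- x1)) + K)"
    have p: "p > 0" unfolding p_def using \<kappa> by (intro divide_pos_pos add_pos_pos mult_pos_pos) auto
    have "eventually (\<lambda>R. ereal (cross_prob M f (ell R) R R) \<le> ereal (1 - p / 2)) at_top"
      using C2(2)[of x2] \<kappa>(3)[of x1] B R_large
    proof eventually_elim
      case (elim R)
      have "ell R \<le> real B / sqrt (ln R)" using elim by (simp add: le_divide_eq)
      also have "\<dots> = \<sigma> * (x1 - x2) / (sqrt 2 * sqrt (ln R))" using \<sigma>(1) by (simp add: x1_def)
      finally have "cross_prob M f (ell R) R R \<le>
          1 - prob (X1.exceeds R (extreme_level R x1)) * (1 - prob (X2.exceeds R (extreme_level R x2)))"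
        using elim by (intro cross_prob_le) (simp_all add: level_diff)
      moreover have "p * (1 / 2) \<le> prob (X1.exceeds R (extreme_level R x1)) * (1 - prob (X2.exceeds R (extreme_level R x2)))"
        using elim(1,2) x2 p unfolding p_def by (intro mult_mono) auto
      ultimately show ?case by simp
    qed
    then have "Limsup at_top (\<lambda>R. ereal (cross_prob M f (ell R) R R)) \<le> ereal (1 - p / 2)"
      by (rule Limsup_bounded)
    also have "\<dots> < 1" using p by simp
    finally show "Limsup at_top (\<lambda>R. ereal (cross_prob M f (ell R) R R)) < 1" .
  qed
qed

end
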